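(* Let $G$ be a complex semisimple Lie group with Lie algebra $\mathfrak g$. Then for any $N\ge2$ a generic $G^{\times N}$-orbit $\mathcal O=Gx_1\times\dots\times Gx_N\subset(\mathfrak g^* )^{\times N}$ is admissible.
   Context: $G^{\times N}$ acts on $(\mathfrak g^* )^{\times N}$ by the coadjoint action. "Generic orbit" means the orbit of a generic point $(x_1,\dots,x_N)$, i.e. of any point of some open dense subset of $(\mathfrak g^* )^{\times N}$. The orbit $\mathcal O=G^{\times N}(x_1,\dots,x_N)$ is called admissible if: (1) there exist $x_1'\in Gx_1,\dots,x_N'\in Gx_N$ whose coadjoint stabilizers $G^{x_j'}\subset G$ have discrete intersection, equivalently $\mathfrak g^{x_1'}\cap\dots\cap\mathfrak g^{x_N'}=\{0\}$; (2) the coadjoint stabilizers $G_j:=G^{x_j}\subset G$ satisfy $\operatorname{rank}G_1=\dots=\operatorname{rank}G_N=\operatorname{rank}G$. Here the rank of a Lie group $H$ with Lie algebra $\mathfrak h$ is the corank (dimension minus maximal rank) of the canonical linear Poisson bivector on $\mathfrak h^*$, i.e. the codimension of generic coadjoint orbits in $\mathfrak h^*$. *)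

theory Defs
  imports "HOL-Analysis.Analysis" "HOL-Algebra.Group"
begin

section \<open>Complex Lie groups\<close>

text \<open>Holomorphy in several variables: on an open set, a map is holomorphic iff at every point it has
  a complex-linear Frechet derivative.  The second version is for maps of two vector variables.\<close>

definition cdifferentiable_at :: "(complex^'n \<Rightarrow> complex^'m) \<Rightarrow> complex^'n \<Rightarrow> bool" where
  "cdifferentiable_at f x \<longleftrightarrow>
     (\<exists>D. (f has_derivative D) (at x) \<and> (\<forall>c v. D (c *s v) = c *s D v))"

definition cdifferentiable2_at ::
  "((complex^'n) \<times> (complex^'k) \<Rightarrow> complex^'m) \<Rightarrow> (complex^'n) \<times> (complex^'k) \<Rightarrow> bool" where
  "cdifferentiable2_at f p \<longleftrightarrow>
     (\<exists>D. (f has_derivative D) (at p) \<and> (\<forall>c u v. D (c *s u, c *s v) = c *s D (u, v)))"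

text \<open>A complex Lie group of complex dimension \<open>CARD('n)\<close>: a group \<open>G\<close> with a topology \<open>T\<close> on its
  carrier and a holomorphic atlas \<open>A\<close>, whose members are pairs of a chart domain and a chart.
  No connectedness is assumed.\<close>

locale complex_lie_group = group G
  for G :: "('g, 'b) monoid_scheme" (structure) +
  fixes T :: "'g topology"
    and A :: "('g set \<times> ('g \<Rightarrow> complex^'n)) set"
  assumes topspace_eq: "topspace T = carrier G"
    and hausdorff: "Hausdorff_space T"
    and second_countable: "second_countable T"
    and atlas_cover: "(\<Union>(U, \<phi>)\<in>A. U) = carrier G"
    and chart: "\<And>U \<phi>. (U, \<phi>) \<in> A \<Longrightarrow>
          openin T U \<and> open (\<phi> ` U) \<and>
          homeomorphic_map (subtopology T U) (top_of_set (\<phi> ` U)) \<phi>"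
    and transition: "\<And>U \<phi> V \<psi> g. (U, \<phi>) \<in> A \<Longrightarrow> (V, \<psi>) \<in> A \<Longrightarrow> g \<in> U \<inter> V \<Longrightarrow>
          cdifferentiable_at (\<lambda>y. \<psi> (inv_into U \<phi> y)) (\<phi> g)"
    and mult_continuous:
          "continuous_map (prod_topology T T) T (\<lambda>(a, b). a \<otimes> b)"
    and mult_holomorphic: "\<And>U \<phi> V \<psi> W \<theta> a b.
          (U, \<phi>) \<in> A \<Longrightarrow> (V, \<psi>) \<in> A \<Longrightarrow> (W, \<theta>) \<in> A \<Longrightarrow>
          a \<in> U \<Longrightarrow> b \<in> V \<Longrightarrow> a \<otimes> b \<in> W \<Longrightarrow>
          cdifferentiable2_at (\<lambda>(y, z). \<theta> (inv_into U \<phi> y \<otimes> inv_into V \<psi> z)) (\<phi> a, \<psi> b)"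
    and inv_continuous: "continuous_map T T (\<lambda>a. inv a)"
    and inv_holomorphic: "\<And>U \<phi> V \<psi> a.
          (U, \<phi>) \<in> A \<Longrightarrow> (V, \<psi>) \<in> A \<Longrightarrow> a \<in> U \<Longrightarrow> inv a \<in> V \<Longrightarrow>
          cdifferentiable_at (\<lambda>y. \<psi> (inv (inv_into U \<phi> y))) (\<phi> a)"


section \<open>The Lie algebra and the adjoint and coadjoint actions\<close>

text \<open>Below, \<open>(U, \<phi>)\<close> is a chart around the unit.  Its differential identifies the tangent space
  \<open>\<gg> = T\<^sub>1G\<close> with \<open>complex^'n\<close>.  \<open>Ad g\<close> is the differential at the unit of conjugation by \<open>g\<close>, and
  the bracket is \<open>[X, Y] = ad X Y\<close> where \<open>ad\<close> is the differential of \<open>Ad\<close> at the unit.\<close>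

definition Ad :: "('g, 'b) monoid_scheme \<Rightarrow> 'g set \<Rightarrow> ('g \<Rightarrow> complex^'n) \<Rightarrow>
    'g \<Rightarrow> complex^'n \<Rightarrow> complex^'n" where
  "Ad G U \<phi> g =
     frechet_derivative (\<lambda>y. \<phi> (g \<otimes>\<^bsub>G\<^esub> inv_into U \<phi> y \<otimes>\<^bsub>G\<^esub> inv\<^bsub>G\<^esub> g)) (at (\<phi> \<one>\<^bsub>G\<^esub>))"

definition bracket :: "('g, 'b) monoid_scheme \<Rightarrow> 'g set \<Rightarrow> ('g \<Rightarrow> complex^'n) \<Rightarrow>
    complex^'n \<Rightarrow> complex^'n \<Rightarrow> complex^'n" where
  "bracket G U \<phi> X Y =
     frechet_derivative (\<lambda>y. Ad G U \<phi> (inv_into U \<phi> y) Y) (at (\<phi> \<one>\<^bsub>G\<^esub>)) X"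

text \<open>The dual \<open>\<gg>*\<close> is \<open>complex^'n\<close> as well, through the bilinear (not Hermitian) pairing.\<close>

definition pairing :: "complex^'n \<Rightarrow> complex^'n \<Rightarrow> complex" where
  "pairing \<xi> X = (\<Sum>i\<in>UNIV. \<xi> $ i * X $ i)"

text \<open>\<open>coAd g \<xi>\<close> is the covector \<open>X \<mapsto> \<langle>\<xi>, Ad g\<^sup>-\<^sup>1 X\<rangle>\<close>, written in coordinates.\<close>

definition coAd :: "('g, 'b) monoid_scheme \<Rightarrow> 'g set \<Rightarrow> ('g \<Rightarrow> complex^'n) \<Rightarrow>
    'g \<Rightarrow> complex^'n \<Rightarrow> complex^'n" where
  "coAd G U \<phi> g \<xi> = (\<chi> i. pairing \<xi> (Ad G U \<phi> (inv\<^bsub>G\<^esub> g) (axis i 1)))"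

definition coad_stabilizer :: "('g, 'b) monoid_scheme \<Rightarrow> 'g set \<Rightarrow> ('g \<Rightarrow> complex^'n) \<Rightarrow>
    complex^'n \<Rightarrow> 'g set" where
  "coad_stabilizer G U \<phi> \<xi> = {g \<in> carrier G. coAd G U \<phi> g \<xi> = \<xi>}"

text \<open>The orbit of a point of \<open>(\<gg>*)\<^sup>N\<close> under the \<open>N\<close>-fold product of \<open>G\<close>, with \<open>N = CARD('N)\<close>.\<close>

definition product_orbit :: "('g, 'b) monoid_scheme \<Rightarrow> 'g set \<Rightarrow> ('g \<Rightarrow> complex^'n) \<Rightarrow>
    (complex^'n)^'N \<Rightarrow> ((complex^'n)^'N) set" where
  "product_orbit G U \<phi> x =
     {(\<chi> j. coAd G U \<phi> (g j) (x $ j)) | g :: 'N \<Rightarrow> 'g. \<forall>j. g j \<in> carrier G}"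


section \<open>Semisimplicity\<close>

definition lie_ideal :: "(complex^'n \<Rightarrow> complex^'n \<Rightarrow> complex^'n) \<Rightarrow> (complex^'n) set \<Rightarrow> bool" where
  "lie_ideal br I \<longleftrightarrow> vec.subspace I \<and> (\<forall>X. \<forall>Y\<in>I. br X Y \<in> I)"

definition derived_algebra ::
  "(complex^'n \<Rightarrow> complex^'n \<Rightarrow> complex^'n) \<Rightarrow> (complex^'n) set \<Rightarrow> (complex^'n) set" where
  "derived_algebra br S = vec.span {br X Y | X Y. X \<in> S \<and> Y \<in> S}"

definition lie_solvable :: "(complex^'n \<Rightarrow> complex^'n \<Rightarrow> complex^'n) \<Rightarrow> (complex^'n) set \<Rightarrow> bool" where
  "lie_solvable br S \<longleftrightarrow> (\<exists>k. (derived_algebra br ^^ k) S = {0})"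

definition lie_semisimple :: "(complex^'n \<Rightarrow> complex^'n \<Rightarrow> complex^'n) \<Rightarrow> bool" where
  "lie_semisimple br \<longleftrightarrow> (\<forall>I. lie_ideal br I \<and> lie_solvable br I \<longrightarrow> I = {0})"


section \<open>Rank of a Lie group\<close>

text \<open>The Lie algebra of a closed subgroup \<open>H\<close>: velocities at the unit of continuously differentiable
  curves in \<open>H\<close>.\<close>

definition lie_algebra_of :: "('g, 'b) monoid_scheme \<Rightarrow> 'g set \<Rightarrow> ('g \<Rightarrow> complex^'n) \<Rightarrow>
    'g set \<Rightarrow> (complex^'n) set" where
  "lie_algebra_of G U \<phi> H =
     {X. \<exists>\<gamma> \<epsilon>. \<epsilon> > 0 \<and> \<gamma> 0 = \<one>\<^bsub>G\<^esub> \<and> \<gamma> ` {-\<epsilon><..<\<epsilon>} \<subseteq> H \<inter> U \<and>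
         (\<phi> \<circ> \<gamma>) C1_differentiable_on {-\<epsilon><..<\<epsilon>} \<and>
         ((\<phi> \<circ> \<gamma>) has_vector_derivative X) (at (0::real))}"

text \<open>For a Lie subalgebra \<open>\<hh>\<close>, every element of \<open>\<hh>*\<close> is the restriction of a covector \<open>\<xi>\<close>.  There
  the linear Poisson bivector is the skew form \<open>(X, Y) \<mapsto> \<langle>\<xi>, [X, Y]\<rangle>\<close> on \<open>\<hh>\<close>, the cotangent space of
  \<open>\<hh>*\<close>; its rank is \<open>dim \<hh>\<close> minus the dimension of its kernel.\<close>

definition poisson_rank :: "(complex^'n \<Rightarrow> complex^'n \<Rightarrow> complex^'n) \<Rightarrow> (complex^'n) set \<Rightarrow>
    complex^'n \<Rightarrow> nat" where
  "poisson_rank br \<hh> \<xi> =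
     vec.dim \<hh> - vec.dim {X \<in> \<hh>. \<forall>Y\<in>\<hh>. pairing \<xi> (br X Y) = 0}"

definition lie_rank :: "(complex^'n \<Rightarrow> complex^'n \<Rightarrow> complex^'n) \<Rightarrow> (complex^'n) set \<Rightarrow> nat" where
  "lie_rank br \<hh> = vec.dim \<hh> - Max (range (poisson_rank br \<hh>))"

definition group_rank :: "('g, 'b) monoid_scheme \<Rightarrow> 'g set \<Rightarrow> ('g \<Rightarrow> complex^'n) \<Rightarrow>
    'g set \<Rightarrow> nat" where
  "group_rank G U \<phi> H = lie_rank (bracket G U \<phi>) (lie_algebra_of G U \<phi> H)"


section \<open>Admissible orbits\<close>

text \<open>Admissibility of the orbit through \<open>x\<close>; up to conjugation of the stabilizers, which does not
  affect ranks, the condition depends only on the orbit.\<close>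

definition admissible_orbit_of :: "('g, 'b) monoid_scheme \<Rightarrow> 'g topology \<Rightarrow> 'g set \<Rightarrow>
    ('g \<Rightarrow> complex^'n) \<Rightarrow> (complex^'n)^'N \<Rightarrow> bool" where
  "admissible_orbit_of G T U \<phi> x \<longleftrightarrow>
     (\<exists>x' \<in> product_orbit G U \<phi> x.
        subtopology T (\<Inter>j. coad_stabilizer G U \<phi> (x' $ j)) =
        discrete_topology (\<Inter>j. coad_stabilizer G U \<phi> (x' $ j))) \<and>
     (\<forall>j. group_rank G U \<phi> (coad_stabilizer G U \<phi> (x $ j)) = group_rank G U \<phi> (carrier G))"

end

theory Submission
  imports Defs "HOL-Complex_Analysis.Conformal_Mappings"
begin

text \<open>For a covector \<open>\<xi>\<close> let \<open>\<gg>\<^sup>\<xi> = {X. \<langle>\<xi>, [X, \<cdot>]\<rangle> = 0}\<close>.  If a linear map \<open>f\<close> has minimal kernel among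
  the maps \<open>f + t h\<close>, then \<open>h\<close> maps the kernel of \<open>f\<close> into the range of \<open>f\<close>.  Applied to the coadjoint
  action on a generic \<open>\<xi>\<close> this shows that \<open>\<gg>\<^sup>\<xi>\<close> is abelian (Duflo and Vergne).  By the constant rank theorem
  the stabilizer of \<open>\<xi>\<close> has Lie algebra \<open>\<gg>\<^sup>\<xi>\<close>, so its rank is \<open>dim \<gg>\<^sup>\<xi>\<close>, which is the rank of \<open>G\<close>.

  For a generic pair, the same perturbation of \<open>\<xi>\<close> alone shows that every \<open>Z \<in> \<gg>\<^sup>\<xi> \<inter> \<gg>\<^sup>\<eta>\<close> is a sandwich
  element: \<open>(ad Z)\<^sup>2 = 0\<close>.  The sandwich elements are closed under the bracket and invariant under \<open>Ad\<close>, so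
  by the Engel--Jacobson argument they span a nilpotent ideal, which vanishes by semisimplicity.  Hence
  already the stabilizers of the components of a generic point have an intersection with zero Lie algebra,
  without moving along the orbit.  Neither the Killing form nor the structure theory of semisimple Lie
  algebras is involved.\<close>

section \<open>Complex linear maps\<close>

text \<open>The bracket is a mixed second derivative of conjugation, while charts and group
  operations are only assumed to have complex-linear first derivatives. Existence and continuity of
  the further derivatives come from Cauchy's formula on complex lines. Antisymmetry is not visible
  from this definition of the bracket: differentiating identities for \<open>Ad\<close> gives
  bilinearity and the Leibniz identity, so the bracket is first treated as that of a left Leibniz
  algebra, and semisimplicity then makes it alternating. Curves in a stabilizer come from the
  inverse function theorem in the chart, and the rank of the orbit map is controlled by right
  translation to the unit.

  The sandwich property takes a pair of covectors because the vector obtained by perturbing \<xi>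
  has to commute with \<open>Z\<close>; regularity of \<eta> ensures this. Genericity is expressed
  by nonvanishing determinants, which are polynomial along lines, so a single point with a small
  kernel yields an open dense set of such points.\<close>

no_notation fps_nth (infixl \<open>$\<close> 75)

abbreviation clinear :: "(complex^'n \<Rightarrow> complex^'m) \<Rightarrow> bool" where
  "clinear \<equiv> Vector_Spaces.linear (*s) (*s)"

lemma clinearI:
  assumes "\<And>x y. f (x + y) = f x + f y" "\<And>c x. f (c *s x) = c *s f x"
  shows "clinear f"
  by unfold_locales (use assms in \<open>auto simp: vec.scale_right_distrib vec.scale_left_distrib\<close>)

lemma clinear_add: "clinear f \<Longrightarrow> f (x + y) = f x + f y"
  and clinear_scale: "clinear f \<Longrightarrow> f (c *s x) = c *s f x"
  and clinear_zero: "clinear f \<Longrightarrow> f 0 = 0"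
  and clinear_diff: "clinear f \<Longrightarrow> f (x - y) = f x - f y"
  and clinear_neg: "clinear f \<Longrightarrow> f (- x) = - f x"
  by (auto simp: vec.linear_add vec.linear_scale vec.linear_0 vec.linear_diff vec.linear_neg)

lemma scaleR_eq_smult: "r *\<^sub>R x = complex_of_real r *s x" for x :: "complex^'n"
  by (simp only: vec_eq_iff vector_scaleR_component vector_smult_component) (simp add: scaleR_conv_of_real)

lemma clinear_imp_linear: "clinear f \<Longrightarrow> linear f"
  by (rule linearI) (auto simp: clinear_add clinear_scale scaleR_eq_smult)

lemma clinear_imp_bounded_linear: "clinear f \<Longrightarrow> bounded_linear f"
  by (rule clinear_imp_linear[THEN linear_conv_bounded_linear[THEN iffD1]])

lemma subspace_kernel: "clinear f \<Longrightarrow> vec.subspace {x. f x = 0}"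
  by (auto simp: vec.subspace_def clinear_add clinear_scale clinear_zero)

lemma norm_smult: "norm (c *s x) = norm c * norm x" for x :: "complex^'n"
  by (simp add: norm_vec_def L2_set_def norm_mult power_mult_distrib real_sqrt_mult
      flip: sum_distrib_left)

lemma exists_projection:
  assumes "vec.subspace K"
  obtains p :: "complex^'n \<Rightarrow> complex^'n"
  where "clinear p" "range p \<subseteq> K" "\<And>x. x \<in> K \<Longrightarrow> p x = x"
  using vec.linear_exists_left_inverse_on[OF vec.linear_id assms] by auto

text \<open>To first order the perturbation moves \<open>Z\<close> out of the kernel, since no value
  of \<open>f\<close> can cancel \<open>h Z\<close>. For small \<open>t\<close> the map
  \<open>q\<close>, which projects to \<open>K\<close> and removes the direction of
  \<open>Z\<close>, is injective on the new kernel and maps it into the proper subspace of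
  \<open>K\<close> where coordinate \<open>i\<close> vanishes.\<close>

lemma kernel_dim_drop:
  fixes f h :: "complex^'n \<Rightarrow> complex^'m"
  assumes f: "clinear f" and h: "clinear h" and fZ: "f Z = 0" and hZ: "h Z \<notin> range f"
  shows "\<exists>t. vec.dim {X. f X + t *s h X = 0} < vec.dim {X. f X = 0}"
proof -
  define K where "K = {X. f X = 0}"
  have K: "vec.subspace K" unfolding K_def by (rule subspace_kernel[OF f])
  obtain p where p: "clinear p" "range p \<subseteq> K" "\<And>x. x \<in> K \<Longrightarrow> p x = x"
    using exists_projection[OF K] by metis
  have pK: "p x \<in> K" for x using p(2) by auto
  have fp: "f (p x) = 0" for x using pK K_def by auto
  have ZK: "Z \<in> K" using fZ K_def by simp
  have Z0: "Z \<noteq> 0" using hZ clinear_zero[OF h] clinear_zero[OF f] by (metis rangeI)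
  then obtain i where i: "Z $ i \<noteq> 0" by (metis vec_eq_iff zero_index)
  define c where "c x = p x $ i / Z $ i" for x
  have c_add: "c (x + y) = c x + c y" and c_scale: "c (a *s x) = a * c x" for x y a
    by (auto simp: c_def clinear_add[OF p(1)] clinear_scale[OF p(1)] add_divide_distrib)
  have cZ: "c Z = 1" using i by (simp add: c_def p(3)[OF ZK])
  \<comment> \<open>\<open>T t\<close> is essentially \<open>f + t h\<close> with the direction of \<open>Z\<close> rescaled by \<open>1 / t\<close>, which makes it
    injective at \<open>t = 0\<close>, hence also for small \<open>t \<noteq> 0\<close>.\<close>
  define T where "T t x = (f (x - p x) + t *s h (x - p x) + c x *s h Z, p x - c x *s Z)" for t x
  have "linear (T 0)"
    by (rule linearI) (auto simp: T_def c_add clinear_add[OF p(1)] clinear_add[OF f] clinear_diff[OF f]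
        clinear_scale[OF p(1)] clinear_scale[OF f] c_scale scaleR_eq_smult algebra_simps vec.scale_right_diff_distrib
         vec.scale_left_distrib)
  moreover have "inj (T 0)"
  proof -
    have "x = 0" if "T 0 x = 0" for x
    proof -
      have 1: "f x + c x *s h Z = 0" and 2: "p x = c x *s Z"
        using that by (auto simp: T_def clinear_diff[OF f] fp zero_prod_def)
      have "c x = 0"
      proof (rule ccontr)
        assume "c x \<noteq> 0"
        have "h Z = (1 / c x) *s (c x *s h Z)" using \<open>c x \<noteq> 0\<close> by simp
        also have "c x *s h Z = f (- x)" using 1 clinear_neg[OF f] by (simp add: add_eq_0_iff)
        also have "(1 / c x) *s f (- x) = f ((1 / c x) *s (- x))" by (simp only: clinear_scale[OF f])
        finally show False using hZ by (metis rangeI)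
      qed
      then have "f x = 0" "p x = 0" using 1 2 by auto
      then show "x = 0" using p(3)[of x] by (simp add: K_def)
    qed
    then show ?thesis using \<open>linear (T 0)\<close> linear_injective_0 by blast
  qed
  ultimately obtain B where B: "B > 0" "\<And>x. B * norm x \<le> norm (T 0 x)"
    using linear_inj_bounded_below_pos by blast
  have "bounded_linear (\<lambda>x. h (x - p x))"
    by (intro clinear_imp_bounded_linear clinearI)
       (auto simp: clinear_add[OF p(1)] clinear_add[OF h] clinear_diff[OF h]
        clinear_scale[OF p(1)] clinear_scale[OF h]  vec.scale_right_diff_distrib)
  then obtain M where M: "M > 0" "\<And>x. norm (h (x - p x)) \<le> norm x * M"
    using bounded_linear.pos_bounded by blast
  \<comment> \<open>With this \<open>t\<close> the term \<open>t *s h (x - p x)\<close> has at most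
    half the size of the lower bound \<open>B * norm x\<close> for \<open>T 0 x\<close>.\<close>
  define t where "t = complex_of_real (B / (2 * M))"
  have t: "norm t * M < B" "t \<noteq> 0" using B(1) M(1) by (auto simp: t_def norm_divide norm_mult)
  have Tinj: "x = 0" if "T t x = 0" for x
  proof (rule ccontr)
    assume "x \<noteq> 0"
    have "T t x = T 0 x + (t *s h (x - p x), 0)" by (simp add: T_def)
    then have "T 0 x = - (t *s h (x - p x), 0)" using that by (simp add: add_eq_0_iff2)
    then have "norm (T 0 x) = norm t * norm (h (x - p x))"
      by (simp add: norm_smult)
    also have "\<dots> \<le> norm t * (norm x * M)" by (intro mult_left_mono M) auto
    also have "\<dots> < B * norm x" using t \<open>x \<noteq> 0\<close> by (simp add: mult.commute mult.left_commute)
    finally show False using B(2)[of x] by simp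
  qed
  define N where "N = {X. f X + t *s h X = 0}"
  define q where "q x = p x - c x *s Z" for x
  have q: "clinear q"
    by (rule clinearI) (auto simp: q_def clinear_add[OF p(1)] clinear_scale[OF p(1)] c_add c_scale
       vec.scale_right_diff_distrib vec.scale_left_distrib)
  have clinN: "clinear (\<lambda>X. f X + t *s h X)"
    by (rule clinearI) (auto simp: clinear_add[OF f] clinear_add[OF h] clinear_scale[OF f] clinear_scale[OF h]
        vec.scale_right_distrib mult.commute)
  have qN: "x = 0" if "x \<in> N" "q x = 0" for x
  proof -
    have px: "p x = c x *s Z" using that(2) by (simp add: q_def)
    \<comment> \<open>\<open>y\<close> is \<open>x\<close> with its component along \<open>Z\<close>
      multiplied by \<open>t\<close>. This undoes the rescaling in \<open>T t\<close>, so that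
      \<open>T t y = 0\<close>.\<close>
    define y where "y = x - p x + (t * c x) *s Z"
    have py: "p y = (t * c x) *s Z"
      by (simp add: y_def clinear_add[OF p(1)] clinear_diff[OF p(1)] clinear_scale[OF p(1)] p(3)[OF pK] p(3)[OF ZK])
    have cy: "c y = t * c x" using i py by (simp add: c_def)
    have yy: "y - p y = x - p x" unfolding py by (simp add: y_def)
    have "f x + t *s h x = 0" using that(1) by (simp add: N_def)
    moreover have "f (x - p x) = f x" "h (x - p x) = h x - c x *s h Z"
      by (simp_all add: clinear_diff[OF f] clinear_diff[OF h] fp) (simp add: px clinear_scale[OF h])
    moreover have "t *s (h x - c x *s h Z) + (t * c x) *s h Z = t *s h x"
      by (simp add: vec.scale_right_diff_distrib)
    ultimately have "T t y = 0"
      unfolding T_def yy unfolding py cy by (simp add: zero_prod_def add.assoc)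
    then have "y = 0" by (rule Tinj)
    then have "(t * c x) *s Z = 0" using py clinear_zero[OF p(1)] by simp
    then have "c x = 0" using t Z0 by simp
    with px \<open>y = 0\<close> show "x = 0" by (simp add: y_def)
  qed
  have N: "vec.subspace N" unfolding N_def by (rule subspace_kernel[OF clinN])
  have "inj_on q N"
  proof (rule inj_onI)
    fix x y assume "x \<in> N" "y \<in> N" "q x = q y"
    then have "q (x - y) = 0" "x - y \<in> N" using clinear_diff[OF q] vec.subspace_diff[OF N] by auto
    then show "x = y" using qN by force
  qed
  then have "vec.dim (q ` N) = vec.dim N"
    using vec.dim_image_eq[OF q, of N] vec.span_eq_iff[THEN iffD2, OF N] by simp
  moreover have "q ` N \<subseteq> {x \<in> K. x $ i = 0}"
    using i pK by (auto simp: q_def c_def intro!: vec.subspace_diff[OF K] vec.subspace_scale[OF K] ZK)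
  moreover have "vec.dim {x \<in> K. x $ i = 0} < vec.dim K"
  proof (rule ccontr)
    assume "\<not> ?thesis"
    moreover have "vec.subspace {x \<in> K. x $ i = 0}" using K by (auto simp: vec.subspace_def)
    ultimately have "{x \<in> K. x $ i = 0} = K" using vec.subspace_dim_equal[OF _ K] by force
    then show False using ZK i by blast
  qed
  ultimately show ?thesis unfolding N_def K_def
    by (metis (no_types, lifting) leD leI le_less_trans vec.dim_subset)
qed

section \<open>The bilinear pairing with covectors\<close>

lemma pairing_add_right: "pairing \<xi> (X + Y) = pairing \<xi> X + pairing \<xi> Y"
  and pairing_scale_right: "pairing \<xi> (c *s X) = c * pairing \<xi> X"
  and pairing_add_left: "pairing (\<xi> + \<eta>) X = pairing \<xi> X + pairing \<eta> X"
  and pairing_scale_left: "pairing (c *s \<xi>) X = c * pairing \<xi> X"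
  and pairing_zero_right [simp]: "pairing \<xi> 0 = 0"
  and pairing_zero_left [simp]: "pairing 0 X = 0"
  and pairing_axis: "pairing \<xi> (axis i 1) = \<xi> $ i"
  by (auto simp: pairing_def sum.distrib sum_distrib_left algebra_simps axis_def if_distrib
      cong: if_cong)

lemma pairing_minus_right: "pairing \<xi> (- X) = - pairing \<xi> X"
  by (simp add: pairing_def sum_negf)

lemma pairing_sum_right: "pairing \<xi> (\<Sum>i\<in>S. f i) = (\<Sum>i\<in>S. pairing \<xi> (f i))"
  by (induction S rule: infinite_finite_induct) (auto simp: pairing_add_right)

lemma pairing_commute: "pairing \<xi> X = pairing X \<xi>"
  by (simp add: pairing_def mult.commute)

lemma pairing_nondegenerate:
  assumes "\<And>\<xi>. pairing \<xi> X = 0" shows "X = 0"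
  using assms[of "axis _ 1"] by (simp add: vec_eq_iff pairing_commute[of "axis _ 1"] pairing_axis)

text \<open>The vector on the left is the transpose of \<open>L\<close> applied to \<xi>. The
  definitions of \<open>coad\<close>, \<open>coAd\<close> and \<open>orbit_map\<close> all have this
  shape, and this is how they are evaluated on a vector.\<close>

lemma pairing_linear_expansion:
  assumes "clinear L"
  shows "pairing (\<chi> i. pairing \<xi> (L (axis i 1))) Y = pairing \<xi> (L Y)"
proof -
  have "L Y = L (\<Sum>i\<in>UNIV. (Y $ i) *s axis i 1)"
    by (simp add: basis_expansion)
  also have "\<dots> = (\<Sum>i\<in>UNIV. (Y $ i) *s L (axis i 1))"
    by (simp add: vec.linear_sum[OF assms] clinear_scale[OF assms])
  finally have "pairing \<xi> (L Y) = (\<Sum>i\<in>UNIV. Y $ i * pairing \<xi> (L (axis i 1)))"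
    by (simp add: pairing_sum_right pairing_scale_right)
  then show ?thesis by (simp add: pairing_def mult.commute)
qed

section \<open>Brackets on \<open>complex^'n\<close>\<close>

locale bilinear_bracket =
  fixes br :: "complex^'n \<Rightarrow> complex^'n \<Rightarrow> complex^'n"
  assumes linear_left: "clinear (\<lambda>X. br X Y)" and linear_right: "clinear (br X)"
begin

lemmas br_add_left = clinear_add[OF linear_left]
  and br_add_right = clinear_add[OF linear_right]
  and br_scale_left = clinear_scale[OF linear_left]
  and br_scale_right = clinear_scale[OF linear_right]
  and br_diff_right = clinear_diff[OF linear_right]
  and br_zero_left = clinear_zero[OF linear_left]
  and br_zero_right = clinear_zero[OF linear_right]

text \<open>Up to sign the infinitesimal coadjoint action of \<open>X\<close> on \<xi>. It is linear
  in both arguments, so that perturbing \<xi> perturbs a linear map in \<open>X\<close>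
  linearly.\<close>

definition coad :: "complex^'n \<Rightarrow> complex^'n \<Rightarrow> complex^'n" where
  "coad \<xi> X = (\<chi> i. pairing \<xi> (br X (axis i 1)))"

definition stab :: "complex^'n \<Rightarrow> (complex^'n) set" where
  "stab \<xi> = {X. coad \<xi> X = 0}"

lemma pairing_coad: "pairing (coad \<xi> X) Y = pairing \<xi> (br X Y)"
  unfolding coad_def by (rule pairing_linear_expansion[OF linear_right])

lemma stab_iff: "X \<in> stab \<xi> \<longleftrightarrow> (\<forall>Y. pairing \<xi> (br X Y) = 0)"
  unfolding stab_def mem_Collect_eq pairing_coad[symmetric]
  by (metis pairing_commute pairing_nondegenerate pairing_zero_left)

lemma clinear_coad: "clinear (coad \<xi>)"
  by (rule clinearI) (auto simp: coad_def vec_eq_iff br_add_left br_scale_left pairing_add_right pairing_scale_right)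

lemma coad_add_left: "coad (\<xi> + \<eta>) X = coad \<xi> X + coad \<eta> X"
  and coad_scale_left: "coad (c *s \<xi>) X = c *s coad \<xi> X"
  by (auto simp: coad_def vec_eq_iff pairing_add_left pairing_scale_left)

lemma subspace_stab: "vec.subspace (stab \<xi>)"
  unfolding stab_def by (rule subspace_kernel[OF clinear_coad])

end

locale leibniz_bracket = bilinear_bracket br for br :: "complex^'n \<Rightarrow> complex^'n \<Rightarrow> complex^'n" +
  assumes leibniz: "br X (br Y Z) = br (br X Y) Z + br Y (br X Z)"
begin

lemma br_br_left: "br (br X Y) Z = br X (br Y Z) - br Y (br X Z)"
  by (simp add: leibniz[of X Y Z])

text \<open>The only form in which semisimplicity enters. It is applied to the span of the squares
  \<open>br X X\<close> and to the centre of the span of the sandwich elements.\<close>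

lemma semisimple_abelian_ideal:
  assumes "lie_semisimple br" "lie_ideal br I" "\<And>X Y. X \<in> I \<Longrightarrow> Y \<in> I \<Longrightarrow> br X Y = 0"
  shows "I = {0}"
proof -
  have "derived_algebra br I \<subseteq> {0}"
    unfolding derived_algebra_def by (rule vec.span_minimal) (use assms(3) in auto)
  moreover have "0 \<in> derived_algebra br I"
    by (simp add: derived_algebra_def vec.span_zero)
  ultimately have "(derived_algebra br ^^ 1) I = {0}" by auto
  then show ?thesis using assms(1,2) unfolding lie_semisimple_def lie_solvable_def by blast
qed

text \<open>The squares of a left Leibniz algebra span an ideal that acts trivially from the left, so the
  bracket of a semisimple left Leibniz algebra is alternating.\<close>

lemma semisimple_imp_alternating:
  assumes "lie_semisimple br"
  shows "br X X = 0"
proof -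
  define S where "S = vec.span (range (\<lambda>X. br X X))"
  \<comment> \<open>On a square the Leibniz identity leaves two equal terms, which cancel.\<close>
  have left: "br Y Z = 0" if "Y \<in> S" for Y Z
    using that unfolding S_def
  proof (induction rule: vec.span_induct)
    case base
    show ?case by (rule subspace_kernel[OF linear_left])
  next
    case (step x)
    then show ?case by (auto simp: br_br_left)
  qed
  have "br X Y \<in> S" if "Y \<in> S" for X Y
    using that unfolding S_def
  proof (induction rule: vec.span_induct)
    case base
    show ?case
      using vec.subspace_span by (auto simp: vec.subspace_def br_add_right br_scale_right br_zero_right)
  next
    case (step x)
    then obtain Y where x: "x = br Y Y" by blast
    \<comment> \<open>Polarization: \<open>br X x\<close> equals \<open>br W Y + br Y W\<close>, a
      combination of the squares of \<open>W + Y\<close>, \<open>W\<close> and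
      \<open>Y\<close>.\<close>
    define W where "W = br X Y"
    have "br X x = br (W + Y) (W + Y) - br W W - br Y Y"
      unfolding x leibniz[of X Y Y] by (simp add: W_def br_add_left br_add_right)
    then show ?case
      by (auto intro!: vec.span_diff intro: vec.span_base)
  qed
  then have "S = {0}"
    by (intro semisimple_abelian_ideal[OF assms]) (auto simp: lie_ideal_def S_def left[unfolded S_def])
  then show ?thesis using vec.span_base[of "br X X" "range (\<lambda>X. br X X)"] by (auto simp: S_def)
qed

end

locale lie_bracket = leibniz_bracket br for br :: "complex^'n \<Rightarrow> complex^'n \<Rightarrow> complex^'n" +
  assumes alternating: "br X X = 0"
begin

lemma antisym: "br X Y = - br Y X"
proof -
  have "br (X + Y) (X + Y) = br X Y + br Y X"
    unfolding br_add_left br_add_right by (simp add: alternating)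
  then show ?thesis using alternating[of "X + Y"] by (metis add_eq_0_iff2)
qed

definition regular :: "complex^'n \<Rightarrow> bool" where
  "regular \<xi> \<longleftrightarrow> (\<forall>\<eta>. vec.dim (stab \<xi>) \<le> vec.dim (stab \<eta>))"

lemma exists_regular: "\<exists>\<xi>. regular \<xi>"
  unfolding regular_def using arg_min_nat_le[of "\<lambda>_. True" _ "\<lambda>\<xi>. vec.dim (stab \<xi>)"] by blast

text \<open>Duflo and Vergne: minimality of the kernel of \<open>coad \<xi>\<close> among the kernels of
  \<open>coad \<xi> + t coad \<alpha>\<close> forces \<open>coad \<alpha>\<close> to map it into the range of \<open>coad \<xi>\<close>, its annihilator.\<close>

lemma stab_regular_abelian:
  assumes "regular \<xi>" "X \<in> stab \<xi>" "Z \<in> stab \<xi>"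
  shows "br Z X = 0"
proof (rule pairing_nondegenerate)
  fix \<alpha>
  have "coad \<alpha> Z \<in> range (coad \<xi>)"
  proof (rule ccontr)
    assume "coad \<alpha> Z \<notin> range (coad \<xi>)"
    moreover have "coad \<xi> Z = 0" using assms(3) by (simp add: stab_def)
    ultimately obtain t where "vec.dim {X. coad \<xi> X + t *s coad \<alpha> X = 0} < vec.dim {X. coad \<xi> X = 0}"
      using kernel_dim_drop[OF clinear_coad clinear_coad] by blast
    moreover have "{X. coad \<xi> X + t *s coad \<alpha> X = 0} = stab (\<xi> + t *s \<alpha>)"
      by (simp add: stab_def coad_add_left coad_scale_left)
    ultimately show False using assms(1) unfolding regular_def by (metis leD stab_def)
  qed
  then obtain W where "coad \<alpha> Z = coad \<xi> W" by auto
  then have "pairing \<alpha> (br Z X) = pairing \<xi> (br W X)" by (metis pairing_coad)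
  also have "\<dots> = - pairing \<xi> (br X W)" by (subst antisym) (simp add: pairing_minus_right)
  finally show "pairing \<alpha> (br Z X) = 0" using assms(2) by (simp add: stab_iff)
qed

section \<open>Sandwich elements\<close>

definition sandwich :: "(complex^'n) set" where
  "sandwich = {Z. \<forall>Y. br Z (br Z Y) = 0}"

text \<open>Take \<eta> regular and \<xi> minimizing the dimension of the intersection. Perturbing
  \<xi> by any \<alpha> with \<eta> fixed yields \<open>X\<close> in \<open>stab \<eta>\<close> with
  \<open>coad \<alpha> Z = coad \<xi> X\<close>. As \<open>stab \<eta>\<close> is abelian,
  \<open>X\<close> commutes with \<open>Z\<close>, so \<open>br X (br Z Y) = br Z (br X Y)\<close>,
  which pairs to zero with \<xi>.\<close>

lemma exists_stab_Int_sandwich: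
  "\<exists>\<xi> \<eta>. stab \<xi> \<inter> stab \<eta> \<subseteq> sandwich"
proof -
  obtain \<eta> where \<eta>: "regular \<eta>" using exists_regular by blast
  define d where "d \<xi> = vec.dim (stab \<xi> \<inter> stab \<eta>)" for \<xi>
  define \<xi> where "\<xi> = arg_min d (\<lambda>_. True)"
  have min: "d \<xi> \<le> d \<zeta>" for \<zeta> unfolding \<xi>_def by (rule arg_min_nat_le) simp
  have "Z \<in> sandwich" if Z: "Z \<in> stab \<xi>" "Z \<in> stab \<eta>" for Z
  proof -
    \<comment> \<open>Values indexed by \<open>'n + 'n\<close> encode the pair of
      \<open>coad \<xi> X\<close> and \<open>coad \<eta> X\<close>, so the kernel is the
      intersection of the two stabilizers.\<close>
    define f :: "complex^'n \<Rightarrow> complex^('n + 'n)" where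
      "f X = (\<chi> s. case s of Inl i \<Rightarrow> coad \<xi> X $ i | Inr i \<Rightarrow> coad \<eta> X $ i)" for X
    have f: "clinear f"
      by (rule clinearI) (auto simp: f_def vec_eq_iff clinear_add[OF clinear_coad] clinear_scale[OF clinear_coad] split: sum.split)
    have "pairing \<alpha> (br Z (br Z Y)) = 0" for \<alpha> Y
    proof -
      define h :: "complex^'n \<Rightarrow> complex^('n + 'n)" where
        "h X = (\<chi> s. case s of Inl i \<Rightarrow> coad \<alpha> X $ i | Inr i \<Rightarrow> 0)" for X
      have h: "clinear h"
        by (rule clinearI) (auto simp: h_def vec_eq_iff clinear_add[OF clinear_coad] clinear_scale[OF clinear_coad] split: sum.split)
      have "h Z \<in> range f"
      proof (rule ccontr)
        assume "h Z \<notin> range f"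
        moreover have "f Z = 0" using Z by (simp add: f_def vec_eq_iff stab_def split: sum.split)
        ultimately obtain t where "vec.dim {X. f X + t *s h X = 0} < vec.dim {X. f X = 0}"
          using kernel_dim_drop[OF f h] by blast
        moreover have "{X. f X + t *s h X = 0} = stab (\<xi> + t *s \<alpha>) \<inter> stab \<eta>"
          by (auto simp: stab_def coad_add_left coad_scale_left f_def h_def vec_eq_iff split_sum_all)
        moreover have "{X. f X = 0} = stab \<xi> \<inter> stab \<eta>"
          by (auto simp: stab_def f_def vec_eq_iff split_sum_all)
        ultimately show False using min[of "\<xi> + t *s \<alpha>"] by (simp add: d_def)
      qed
      then obtain X where X: "h Z = f X" by auto
      have "coad \<alpha> Z $ i = coad \<xi> X $ i" "0 = coad \<eta> X $ i" for i
        using arg_cong[OF X, of "\<lambda>v. v $ Inl i"] arg_cong[OF X, of "\<lambda>v. v $ Inr i"]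
        by (simp_all add: h_def f_def)
      then have X: "coad \<alpha> Z = coad \<xi> X" and "X \<in> stab \<eta>" by (simp_all add: vec_eq_iff stab_def)
      then have XZ: "br X Z = 0" using stab_regular_abelian[OF \<eta> Z(2)] by blast
      have "pairing \<alpha> (br Z (br Z Y)) = pairing \<xi> (br X (br Z Y))"
        using X by (metis pairing_coad)
      also have "\<dots> = 0" using Z(1) by (simp add: leibniz[of X] XZ br_zero_left stab_iff)
      finally show ?thesis .
    qed
    then have "br Z (br Z Y) = 0" for Y by (intro pairing_nondegenerate)
    then show ?thesis by (simp add: sandwich_def)
  qed
  then show ?thesis by blast
qed

lemma sandwichD: "Z \<in> sandwich \<Longrightarrow> br Z (br Z Y) = 0"
  by (simp add: sandwich_def)

text \<open>Expand the operator of \<open>br Z (br Z Y)\<close>, which is zero: the terms containing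
  the square of \<open>br Z\<close> vanish, and what remains is -2 times the claim. This identity
  gives sandwich elements their name.\<close>

lemma sandwich_triple:
  assumes "Z \<in> sandwich"
  shows "br Z (br Y (br Z W)) = 0"
proof -
  have "0 = br (br Z (br Z Y)) W" using sandwichD[OF assms] br_zero_left[of W] by metis
  also have "\<dots> = - 2 *s br Z (br Y (br Z W))"
    unfolding br_br_left[of Z "br Z Y"] unfolding br_br_left[of Z Y]
    by (simp add: br_diff_right sandwichD[OF assms] br_zero_right vec_eq_iff)
  finally show ?thesis by simp
qed

text \<open>The square of the operator of \<open>br Z W\<close> expands into four words of length
  four in \<open>br Z\<close> and \<open>br W\<close>. Each contains a squared factor or a pattern
  as in \<open>sandwich_triple\<close>.\<close>

lemma sandwich_br:
  assumes "Z \<in> sandwich" "W \<in> sandwich"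
  shows "br Z W \<in> sandwich"
proof -
  have "br (br Z W) (br (br Z W) Y) = 0" for Y
    unfolding br_br_left[of Z W]
    by (simp add: br_diff_right sandwich_triple[OF assms(1)] sandwich_triple[OF assms(2)]
        sandwichD[OF assms(1)] sandwichD[OF assms(2)] br_zero_right)
  then show ?thesis by (simp add: sandwich_def)
qed

section \<open>Nilpotency of the span of the sandwich elements\<close>

text \<open>\<open>lc W k = {0}\<close> means that the operators \<open>br w\<close>, \<open>w \<in> W\<close>, generate a nilpotent associative algebra.\<close>

primrec lc :: "(complex^'n) set \<Rightarrow> nat \<Rightarrow> (complex^'n) set" where
  "lc W 0 = UNIV"
| "lc W (Suc m) = vec.span {br w x | w x. w \<in> W \<and> x \<in> lc W m}"

lemma subspace_lc: "vec.subspace (lc W m)"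
  by (cases m) auto

lemma lc_SucI: "w \<in> W \<Longrightarrow> x \<in> lc W m \<Longrightarrow> br w x \<in> lc W (Suc m)"
  by (auto intro!: vec.span_base)

lemma lc_Suc_subset: "lc W (Suc m) \<subseteq> lc W m"
proof (induction m)
  case (Suc m)
  then show ?case unfolding lc.simps(2)[of W "Suc m"]
    by (intro vec.span_minimal subspace_lc) (auto intro: lc_SucI simp del: lc.simps(2))
qed auto

lemma lc_Suc_minimal:
  assumes "vec.subspace S" "\<And>w x. w \<in> W \<Longrightarrow> x \<in> lc W m \<Longrightarrow> br w x \<in> S"
  shows "lc W (Suc m) \<subseteq> S"
  unfolding lc.simps by (rule vec.span_minimal) (use assms in auto)

text \<open>Engel and Jacobson: a nilpotent subalgebra spanned by sandwich elements can be enlarged by a further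
  sandwich element that normalizes it, until it contains all of them.\<close>

lemma lc_adjoin:
  assumes W: "vec.subspace W" and Y: "Y \<in> sandwich" and WY: "\<And>w. w \<in> W \<Longrightarrow> br w Y \<in> W"
  defines "W' \<equiv> vec.span (insert Y W)"
  shows "lc W' (2 * m) \<subseteq> lc W m"
proof -
  \<comment> \<open>\<open>Y\<close> normalizes \<open>W\<close>, so \<open>br Y\<close> moves past
    \<open>br w\<close> at the cost of the operator of \<open>br w Y\<close>, again an element of
    \<open>W\<close>. Hence it preserves every level.\<close>
  have Y_lc: "br Y x \<in> lc W m" if "x \<in> lc W m" for x m
    using that
  proof (induction m arbitrary: x)
    case (Suc m)
    have "lc W (Suc m) \<subseteq> {x. br Y x \<in> lc W (Suc m)}"
    proof (rule lc_Suc_minimal)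
      show "vec.subspace {x. br Y x \<in> lc W (Suc m)}"
        using subspace_lc[of W "Suc m"] by (auto simp: vec.subspace_def br_add_right br_scale_right br_zero_right simp del: lc.simps)
      fix w x assume w: "w \<in> W" and x: "x \<in> lc W m"
      have "br Y (br w x) = br w (br Y x) - br (br w Y) x"
        by (simp add: br_br_left)
      then show "br w x \<in> {x. br Y x \<in> lc W (Suc m)}"
        using w x Suc.IH WY by (auto intro!: vec.subspace_diff[OF subspace_lc] lc_SucI simp del: lc.simps)
    qed
    then show ?case using Suc.prems by auto
  qed simp
  have split: "\<exists>w c. w \<in> W \<and> u = w + c *s Y" if u: "u \<in> W'" for u
  proof -
    obtain c where "u - c *s Y \<in> W"
      using u vec.span_eq_iff[THEN iffD2, OF W] unfolding W'_def vec.span_insert by auto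
    then show ?thesis by (intro exI[of _ "u - c *s Y"] exI[of _ c]) simp
  qed
  show ?thesis
  proof (induction m)
    case (Suc m)
    have "lc W' (Suc (Suc (2 * m))) \<subseteq> lc W (Suc m)"
    proof (rule lc_Suc_minimal[OF subspace_lc])
      fix u x assume u: "u \<in> W'" and "x \<in> lc W' (Suc (2 * m))"
      moreover have "lc W' (Suc (2 * m)) \<subseteq> {x. br u x \<in> lc W (Suc m)}"
      proof (rule lc_Suc_minimal)
        show "vec.subspace {x. br u x \<in> lc W (Suc m)}"
          using subspace_lc[of W "Suc m"] by (auto simp: vec.subspace_def br_add_right br_scale_right br_zero_right simp del: lc.simps)
        fix u' x assume u': "u' \<in> W'" and "x \<in> lc W' (2 * m)"
        then have x: "x \<in> lc W m" using Suc by blast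
        obtain w c where w: "w \<in> W" "u = w + c *s Y" using split[OF u] by blast
        obtain w' c' where w': "w' \<in> W" "u' = w' + c' *s Y" using split[OF u'] by blast
        have 1: "br w (br w' x) \<in> lc W (Suc m)"
          by (rule subsetD[OF lc_Suc_subset]) (intro lc_SucI w w' x)
        have 2: "br w (br Y x) \<in> lc W (Suc m)" by (intro lc_SucI w Y_lc x)
        have 3: "br Y (br w' x) \<in> lc W (Suc m)" by (intro Y_lc lc_SucI w' x)
        \<comment> \<open>Of the four terms, the one with \<open>Y\<close> twice vanishes because
          \<open>Y\<close> is a sandwich element, and the others contain a factor from
          \<open>W\<close>. Thus two steps for \<open>W'\<close> descend at least one level for
          \<open>W\<close>, whence the factor 2.\<close>
        have "br u (br u' x) = br w (br w' x) + c' *s br w (br Y x) + c *s br Y (br w' x)"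
          unfolding w w' by (simp add: br_add_left br_add_right br_scale_left br_scale_right sandwichD[OF Y])
        then show "br u' x \<in> {x. br u x \<in> lc W (Suc m)}"
          using 1 2 3 by (auto intro!: vec.subspace_add[OF subspace_lc] vec.subspace_scale[OF subspace_lc] simp del: lc.simps)
      qed
      ultimately show "br u x \<in> lc W (Suc m)" by blast
    qed
    then show ?case by (simp del: lc.simps)
  qed simp
qed

text \<open>Being spanned by sandwich elements is recorded so that normalization of \<open>W\<close>
  by a sandwich element \<open>Y\<close> can be tested on sandwich elements of \<open>W\<close>,
  whose brackets with \<open>Y\<close> are again sandwich elements.\<close>

definition nil_subalgebra :: "(complex^'n) set \<Rightarrow> bool" where
  "nil_subalgebra W \<longleftrightarrow> W = vec.span (W \<inter> sandwich) \<and> (\<forall>a\<in>W. \<forall>b\<in>W. br a b \<in> W) \<and> (\<exists>k. lc W k = {0})"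

lemma nil_subalgebra_extend:
  assumes "nil_subalgebra W" "Y0 \<in> sandwich" "Y0 \<notin> W"
  shows "\<exists>W'. nil_subalgebra W' \<and> vec.dim W < vec.dim W'"
proof -
  obtain k where k: "lc W k = {0}" and W: "W = vec.span (W \<inter> sandwich)"
    and closed: "\<And>a b. a \<in> W \<Longrightarrow> b \<in> W \<Longrightarrow> br a b \<in> W"
    using assms(1) by (auto simp: nil_subalgebra_def)
  have sW: "vec.subspace W" using W by (metis vec.subspace_span)
  \<comment> \<open>The new element is taken from the deepest level of \<open>lc W\<close> that has
    a sandwich element outside \<open>W\<close>. Its brackets with sandwich elements of
    \<open>W\<close> lie one level deeper, hence in \<open>W\<close>.\<close>
  define P where "P m \<longleftrightarrow> (\<exists>Y. Y \<in> sandwich \<and> Y \<in> lc W m \<and> Y \<notin> W)" for m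
  have "P 0" using assms by (auto simp: P_def)
  moreover have "\<not> P k" using k vec.subspace_0[OF sW] by (auto simp: P_def)
  ultimately obtain m where "P m" "\<not> P (Suc m)"
    by (metis nat_induct)
  then obtain Y where Y: "Y \<in> sandwich" "Y \<in> lc W m" "Y \<notin> W"
    by (auto simp: P_def)
  have WY: "br w Y \<in> W" if "w \<in> W" for w
  proof -
    have "w \<in> vec.span (W \<inter> sandwich)" using that W by simp
    then show ?thesis
    proof (induction rule: vec.span_induct)
      case base
      show ?case using sW by (auto simp: vec.subspace_def br_add_left br_scale_left br_zero_left)
    next
      case (step x)
      then show ?case using \<open>\<not> P (Suc m)\<close> Y sandwich_br lc_SucI unfolding P_def by blast
    qed
  qed
  define W' where "W' = vec.span (insert Y W)"
  have split: "\<exists>w c. w \<in> W \<and> u = w + c *s Y" if u: "u \<in> W'" for u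
  proof -
    obtain c where "u - c *s Y \<in> W"
      using u vec.span_eq_iff[THEN iffD2, OF sW] unfolding W'_def vec.span_insert by auto
    then show ?thesis by (intro exI[of _ "u - c *s Y"] exI[of _ c]) simp
  qed
  have WW': "W \<subseteq> W'" "Y \<in> W'" unfolding W'_def by (auto intro: vec.span_base)
  have sW': "vec.subspace W'" by (simp add: W'_def)
  have "W' = vec.span (W' \<inter> sandwich)"
  proof
    show "vec.span (W' \<inter> sandwich) \<subseteq> W'"
      using sW' by (intro vec.span_minimal) auto
    have "W \<subseteq> vec.span (W' \<inter> sandwich)"
      by (subst W, rule vec.span_mono) (use WW' in blast)
    moreover have "Y \<in> vec.span (W' \<inter> sandwich)"
      using Y WW' by (auto intro: vec.span_base)
    ultimately show "W' \<subseteq> vec.span (W' \<inter> sandwich)" unfolding W'_def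
      by (intro vec.span_minimal) auto
  qed
  moreover have "br a b \<in> W'" if ab: "a \<in> W'" "b \<in> W'" for a b
  proof -
    obtain w c where w: "w \<in> W" "a = w + c *s Y" using split[OF ab(1)] by blast
    obtain w' c' where w': "w' \<in> W" "b = w' + c' *s Y" using split[OF ab(2)] by blast
    have "br Y w' = - br w' Y" by (rule antisym)
    then have "br a b = br w w' + c' *s br w Y - c *s br w' Y"
      unfolding w w' by (simp add: br_add_left br_add_right br_scale_left br_scale_right alternating algebra_simps)
    then have "br a b \<in> W"
      by (auto intro!: vec.subspace_add[OF sW] vec.subspace_diff[OF sW] vec.subspace_scale[OF sW] closed WY w w')
    then show ?thesis using WW' by blast
  qed
  moreover have "lc W' (2 * k) = {0}"
    using lc_adjoin[OF sW Y(1) WY, of k] k vec.subspace_0[OF subspace_lc, of W' "2 * k"] by (auto simp: W'_def)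
  ultimately have "nil_subalgebra W'" unfolding nil_subalgebra_def by blast
  moreover have "vec.dim W < vec.dim W'"
    using vec.subspace_dim_equal[OF sW sW' WW'(1)] WW' Y by force
  ultimately show ?thesis by blast
qed

text \<open>Dimensions are bounded, so some such subalgebra has maximal dimension, and it cannot
  miss a sandwich element. The zero algebra shows that there is one at all.\<close>

lemma nil_subalgebra_span_sandwich: "nil_subalgebra (vec.span sandwich)"
proof -
  have ex: "nil_subalgebra {0}"
  proof -
    have "{0} \<inter> sandwich = {0}" by (simp add: sandwich_def br_zero_left)
    moreover have "lc {0} (Suc 0) \<subseteq> {0}"
      by (rule lc_Suc_minimal) (auto simp: br_zero_left)
    then have "lc {0} (Suc 0) = {0}"
      using vec.subspace_0[OF subspace_lc, of "{0}" "Suc 0"] by blast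
    ultimately show ?thesis
      unfolding nil_subalgebra_def by (metis br_zero_left insertI1 singletonD vec.span_insert_0 vec.span_empty)
  qed
  have "\<forall>W. nil_subalgebra W \<longrightarrow> vec.dim W < Suc (vec.dim (UNIV :: (complex^'n) set))"
    by (metis le_imp_less_Suc subset_UNIV vec.dim_subset)
  then obtain W where W: "nil_subalgebra W" "\<And>W'. nil_subalgebra W' \<Longrightarrow> vec.dim W' \<le> vec.dim W"
    using ex_has_greatest_nat[of nil_subalgebra "{0}" vec.dim, OF ex] by blast
  then have "sandwich \<subseteq> W"
    using nil_subalgebra_extend by (meson leD subsetI)
  then have "W \<inter> sandwich = sandwich" by blast
  then have "W = vec.span sandwich" using W(1) by (simp add: nil_subalgebra_def)
  then show ?thesis using W by simp
qed

text \<open>If the ideal \<open>J\<close> spanned by the sandwich elements were nonzero, its last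
  nonzero intersection with the levels \<open>lc J m\<close> would consist of elements killed by
  \<open>J\<close>. These lie in the centre \<open>C\<close> of \<open>J\<close>, an abelian ideal,
  which is zero by semisimplicity.\<close>

lemma semisimple_sandwich:
  assumes "lie_semisimple br" and inv: "\<And>X Z. Z \<in> sandwich \<Longrightarrow> br X Z \<in> vec.span sandwich"
  shows "sandwich = {0}"
proof -
  define J where "J = vec.span sandwich"
  have sJ: "vec.subspace J" by (simp add: J_def)
  have ideal: "br X Z \<in> J" if "Z \<in> J" for X Z
    using that unfolding J_def
  proof (induction rule: vec.span_induct)
    case base
    show ?case using sJ by (auto simp: vec.subspace_def br_add_right br_scale_right br_zero_right J_def)
  qed (rule inv)
  obtain k where k: "lc J k = {0}"
    using nil_subalgebra_span_sandwich by (auto simp: nil_subalgebra_def J_def)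
  define C where "C = {v \<in> J. \<forall>w\<in>J. br w v = 0}"
  have ideal': "br X Z \<in> J" if "X \<in> J" for X Z
    using ideal[OF that, of Z] antisym[of X Z] vec.subspace_neg[OF sJ] by simp
  have "lie_ideal br C"
    unfolding lie_ideal_def
  proof (intro conjI allI ballI)
    show "vec.subspace C" using sJ by (auto simp: C_def vec.subspace_def br_add_right br_scale_right br_zero_right)
    fix X v assume "v \<in> C"
    then show "br X v \<in> C"
      using ideal ideal' by (auto simp: C_def leibniz[of _ X v] br_zero_right)
  qed
  then have "C = {0}"
    by (rule semisimple_abelian_ideal[OF assms(1)]) (auto simp: C_def)
  have "J = {0}"
  proof (rule ccontr)
    assume "J \<noteq> {0}"
    define P where "P m \<longleftrightarrow> J \<inter> lc J m \<noteq> {0}" for m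
    have "P 0" using \<open>J \<noteq> {0}\<close> by (simp add: P_def)
    moreover have "\<not> P k" using k vec.subspace_0[OF sJ] by (auto simp: P_def)
    ultimately obtain m where m: "P m" "\<not> P (Suc m)"
      by (metis nat_induct)
    moreover have "0 \<in> J \<inter> lc J m" using vec.subspace_0 sJ subspace_lc by blast
    ultimately obtain v where v: "v \<in> J" "v \<in> lc J m" "v \<noteq> 0" unfolding P_def by blast
    have "br w v = 0" if "w \<in> J" for w
      using lc_SucI[OF that v(2)] ideal[OF v(1), of w] m(2) unfolding P_def by blast
    then have "v \<in> C" using v by (simp add: C_def)
    then show False using \<open>C = {0}\<close> v by simp
  qed
  moreover have "0 \<in> sandwich" by (simp add: sandwich_def br_zero_left)
  ultimately show ?thesis unfolding J_def using vec.span_superset[of sandwich] by auto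
qed

end

section \<open>Generic points\<close>

lemma holomorphic_on_det:
  assumes "\<And>i j. (\<lambda>z. B z $ i $ j) holomorphic_on S"
  shows "(\<lambda>z. det (B z :: complex^'n^'n)) holomorphic_on S"
  unfolding det_def using assms by (intro holomorphic_intros)

text \<open>On the line from \<open>x\<close> to \<open>x0\<close> the determinant is a polynomial
  in the real parameter. Extended to a complex variable it is entire and nonzero at 1, so by the
  identity theorem it cannot vanish on a whole interval of small positive parameters.\<close>

lemma open_dense_det_nonzero:
  fixes B :: "'v::euclidean_space \<Rightarrow> complex^'n^'n"
  assumes aff: "\<And>x y t. B (x + t *\<^sub>R (y - x)) = B x + t *\<^sub>R (B y - B x)"
    and cont: "continuous_on UNIV B" and x0: "det (B x0) \<noteq> 0"
  shows "open {x. det (B x) \<noteq> 0}" "closure {x. det (B x) \<noteq> 0} = UNIV"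
proof -
  have "continuous_on UNIV (\<lambda>x. det (B x))"
    unfolding det_def by (intro continuous_intros cont)
  then show "open {x. det (B x) \<noteq> 0}"
    by (intro open_Collect_neq) auto
  have "x \<in> closure {x. det (B x) \<noteq> 0}" for x
    unfolding closure_approachable
  proof (intro allI impI)
    fix e :: real assume "e > 0"
    define g where "g z = det (\<chi> i j. B x $ i $ j + z * (B x0 - B x) $ i $ j)" for z
    have hol: "g holomorphic_on UNIV"
      unfolding g_def by (intro holomorphic_on_det) (auto intro!: holomorphic_intros)
    have g: "g (of_real t) = det (B (x + t *\<^sub>R (x0 - x)))" for t
      unfolding g_def aff by (rule arg_cong[of _ _ det])
        (simp only: vec_eq_iff vec_lambda_beta vector_add_component vector_scaleR_component, simp add: scaleR_conv_of_real)
    \<comment> \<open>Parameters below \<open>d\<close> move \<open>x\<close> by less than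
      \<open>e\<close>; adding 1 keeps the denominator positive even if
      \<open>x0 = x\<close>.\<close>
    define d where "d = e / 2 / (norm (x0 - x) + 1)"
    have d: "d > 0" "d * norm (x0 - x) < e"
    proof -
      show "d > 0" using \<open>e > 0\<close> unfolding d_def by (intro divide_pos_pos) (auto simp: add_nonneg_pos)
      have "d * norm (x0 - x) \<le> d * (norm (x0 - x) + 1)" using \<open>d > 0\<close> by simp
      also have "\<dots> = e / 2"
      proof -
        have "norm (x0 - x) + 1 \<noteq> 0" using norm_ge_zero[of "x0 - x"] by linarith
        then show ?thesis unfolding d_def by (rule nonzero_eq_divide_eq[THEN iffD1, OF _ refl])
      qed
      finally show "d * norm (x0 - x) < e" using \<open>e > 0\<close> by simp
    qed
    have "\<exists>t\<in>{0<..<d}. g (of_real t) \<noteq> 0"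
    proof (rule ccontr)
      assume "\<not> ?thesis"
      then have zero: "g z = 0" if "z \<in> of_real ` {0<..<d}" for z using that by auto
      have lim: "0 islimpt complex_of_real ` {0<..<d}"
        unfolding islimpt_approachable
      proof (intro allI impI)
        fix r :: real assume "r > 0"
        then show "\<exists>y\<in>complex_of_real ` {0<..<d}. y \<noteq> 0 \<and> dist y 0 < r"
          using d(1) by (intro bexI[of _ "of_real (min r d / 2)"] imageI) auto
      qed
      have "g 1 = 0"
        by (rule analytic_continuation[OF hol open_UNIV connected_UNIV _ _ lim zero]) auto
      then show False using g[of 1] x0 by simp
    qed
    then obtain t where t: "0 < t" "t < d" "det (B (x + t *\<^sub>R (x0 - x))) \<noteq> 0" using g by auto
    have "dist (x + t *\<^sub>R (x0 - x)) x = t * norm (x0 - x)" using t by (simp add: dist_norm)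
    also have "\<dots> \<le> d * norm (x0 - x)" using t by (intro mult_right_mono) auto
    finally show "\<exists>y\<in>{x. det (B x) \<noteq> 0}. dist y x < e" using t d(2) by (intro bexI) auto
  qed
  then show "closure {x. det (B x) \<noteq> 0} = UNIV" by auto
qed

text \<open>Upper semicontinuity of the kernel dimension, by a determinant. \<open>Q\<close> inverts
  \<open>f x0\<close> on a complement of its kernel \<open>K\<close>, so \<open>b x0\<close> is the
  identity. Wherever \<open>b x\<close> is invertible, \<open>p\<close> embeds the kernel of
  \<open>f x\<close> into \<open>K\<close>.\<close>

lemma kernel_dim_generic:
  fixes f :: "'v::euclidean_space \<Rightarrow> complex^'n \<Rightarrow> complex^'m"
  assumes f: "\<And>x. clinear (f x)" and lin: "\<And>X. linear (\<lambda>x. f x X)"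
  shows "\<exists>D. open D \<and> closure D = UNIV \<and>
           (\<forall>x\<in>D. vec.dim {X. f x X = 0} \<le> vec.dim {X. f x0 X = 0})"
proof -
  define K where "K = {X. f x0 X = 0}"
  have K: "vec.subspace K" unfolding K_def by (rule subspace_kernel[OF f])
  obtain p where p: "clinear p" "range p \<subseteq> K" "\<And>x. x \<in> K \<Longrightarrow> p x = x"
    using exists_projection[OF K] by metis
  have pK: "p x \<in> K" for x using p(2) by auto
  have ker_p: "vec.subspace {X. p X = 0}" by (rule subspace_kernel[OF p(1)])
  have "inj_on (f x0) {X. p X = 0}"
  proof (rule inj_onI)
    fix X Y assume "X \<in> {X. p X = 0}" "Y \<in> {X. p X = 0}" "f x0 X = f x0 Y"
    then have "p (X - Y) = 0" "X - Y \<in> K" using clinear_diff[OF p(1)] clinear_diff[OF f] by (auto simp: K_def)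
    then show "X = Y" using p(3) by force
  qed
  from vec.linear_exists_left_inverse_on[OF f ker_p this]
  obtain Q where Q: "clinear Q" "\<And>X. p X = 0 \<Longrightarrow> Q (f x0 X) = X" by auto
  define b where "b x X = Q (f x X) + p X" for x X
  have b: "clinear (b x)" for x
    by (rule clinearI) (auto simp: b_def clinear_add[OF p(1)] clinear_add[OF f] clinear_add[OF Q(1)]
        clinear_scale[OF p(1)] clinear_scale[OF f] clinear_scale[OF Q(1)] vec.scale_right_distrib)
  have b0: "b x0 X = X" for X
  proof -
    have "p (X - p X) = 0" by (simp add: clinear_diff[OF p(1)] p(3)[OF pK])
    then have "Q (f x0 (X - p X)) = X - p X" by (rule Q(2))
    moreover have "f x0 (X - p X) = f x0 X" using pK[of X] by (simp add: clinear_diff[OF f] K_def)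
    ultimately show ?thesis by (simp add: b_def)
  qed
  define B where "B x = matrix (b x)" for x
  have B: "B x *v X = b x X" for x X unfolding B_def by (rule matrix_works[OF b])
  have det: "det (B x0) \<noteq> 0"
  proof -
    have "B x0 = mat 1"
      by (metis B b0 matrix_eq matrix_vector_mul_lid)
    then show ?thesis by simp
  qed
  have QR: "linear Q" by (rule clinear_imp_linear[OF Q(1)])
  have aff: "B (x + t *\<^sub>R (y - x)) = B x + t *\<^sub>R (B y - B x)" for x y t
    by (simp add: vec_eq_iff B_def matrix_def b_def linear_add[OF lin] linear_scale[OF lin] linear_diff[OF lin]
        linear_add[OF QR] linear_scale[OF QR] linear_diff[OF QR])
  have "linear (\<lambda>x. Q (f x X))" for X
    using linear_compose[OF lin QR] by (simp add: o_def)
  then have "continuous_on UNIV (\<lambda>x. Q (f x X))" for X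
    by (simp add: linear_continuous_on linear_conv_bounded_linear)
  then have cont: "continuous_on UNIV B"
    unfolding B_def matrix_def b_def by (intro continuous_intros)
  have "vec.dim {X. f x X = 0} \<le> vec.dim K" if "det (B x) \<noteq> 0" for x
  proof -
    have "inj (b x)" using that B by (metis (full_types) ext inj_matrix_vector_mult invertible_det_nz)
    have sub: "vec.subspace {X. f x X = 0}" by (rule subspace_kernel[OF f])
    have "inj_on p {X. f x X = 0}"
    proof (rule inj_onI)
      fix X Y assume "X \<in> {X. f x X = 0}" "Y \<in> {X. f x X = 0}" "p X = p Y"
      then have "b x X = b x Y" by (simp add: b_def)
      then show "X = Y" using \<open>inj (b x)\<close> by (simp add: inj_eq)
    qed
    then have "vec.dim (p ` {X. f x X = 0}) = vec.dim {X. f x X = 0}"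
      using vec.dim_image_eq[OF p(1), of "{X. f x X = 0}"] vec.span_eq_iff[THEN iffD2, OF sub] by simp
    moreover have "p ` {X. f x X = 0} \<subseteq> K" using pK by blast
    ultimately show ?thesis by (metis vec.dim_subset)
  qed
  then show ?thesis
    using open_dense_det_nonzero[OF aff cont det] by (intro exI[of _ "{x. det (B x) \<noteq> 0}"]) (auto simp: K_def)
qed

lemma dense_Int:
  fixes A B :: "'a::topological_space set"
  assumes "open A" "closure A = UNIV" "closure B = UNIV"
  shows "closure (A \<inter> B) = UNIV"
  using open_Int_closure_subset[OF assms(1), of B] assms closure_mono[of A "closure (A \<inter> B)"] by auto

lemma open_dense_INT:
  fixes D :: "'i \<Rightarrow> 'a::topological_space set"
  assumes "finite I" "\<And>i. i \<in> I \<Longrightarrow> open (D i) \<and> closure (D i) = UNIV"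
  shows "open (\<Inter>i\<in>I. D i) \<and> closure (\<Inter>i\<in>I. D i) = UNIV"
  using assms
proof (induction I rule: finite_induct)
  case (insert i I)
  then show ?case using dense_Int[of "D i" "\<Inter>i\<in>I. D i"] by auto
qed auto

context lie_bracket
begin

lemma linear_coad_left: "linear (\<lambda>x. coad x X)"
  by (rule linearI) (auto simp: coad_add_left coad_scale_left scaleR_eq_smult)

text \<open>Both conditions bound the kernel of a map that depends linearly on \<open>x\<close>, so
  each holds on an open dense set once it holds at one point: a tuple of equal regular covectors for
  regularity, and a tuple containing a pair with trivial common stabilizer for the
  intersection.\<close>

theorem generic_stab:
  assumes "lie_semisimple br" and "\<And>X Z. Z \<in> sandwich \<Longrightarrow> br X Z \<in> vec.span sandwich"
    and "j1 \<noteq> (j2 :: 'N::finite)"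
  shows "\<exists>D :: ((complex^'n)^'N) set. open D \<and> closure D = UNIV \<and>
          (\<forall>x\<in>D. (\<forall>j. regular (x $ j)) \<and> (\<Inter>j. stab (x $ j)) = {0})"
proof -
  obtain \<xi> where "regular \<xi>" using exists_regular by blast
  have "\<exists>D :: ((complex^'n)^'N) set. open D \<and> closure D = UNIV \<and> (\<forall>x\<in>D. regular (x $ j))" for j
  proof -
    have lin: "linear (\<lambda>x :: (complex^'n)^'N. coad (x $ j) X)" for X
      using linear_compose[OF _ linear_coad_left, of "\<lambda>x. x $ j"]
      by (simp add: o_def linear_iff)
    show ?thesis
    proof -
      obtain D :: "((complex^'n)^'N) set" where D: "open D" "closure D = UNIV"
        "\<And>x. x \<in> D \<Longrightarrow> vec.dim {X. coad (x $ j) X = 0} \<le> vec.dim {X. coad ((\<chi> j. \<xi>) $ j) X = 0}"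
        using kernel_dim_generic[OF clinear_coad lin, of "\<chi> j. \<xi>"] by blast
      have "regular (x $ j)" if "x \<in> D" for x
        unfolding regular_def
      proof
        fix \<eta>
        have "vec.dim (stab (x $ j)) \<le> vec.dim (stab \<xi>)" using D(3)[OF that] by (simp add: stab_def)
        also have "\<dots> \<le> vec.dim (stab \<eta>)" using \<open>regular \<xi>\<close> by (simp add: regular_def)
        finally show "vec.dim (stab (x $ j)) \<le> vec.dim (stab \<eta>)" .
      qed
      then show ?thesis using D by blast
    qed
  qed
  then obtain R :: "'N \<Rightarrow> ((complex^'n)^'N) set"
    where R: "\<And>j. open (R j) \<and> closure (R j) = UNIV" "\<And>j x. x \<in> R j \<Longrightarrow> regular (x $ j)"
    by metis
  obtain \<xi>1 \<xi>2 where \<xi>: "stab \<xi>1 \<inter> stab \<xi>2 \<subseteq> {0}"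
    using exists_stab_Int_sandwich semisimple_sandwich[OF assms(1,2)] by metis
  define f :: "(complex^'n)^'N \<Rightarrow> complex^'n \<Rightarrow> complex^('n + 'n)" where
    "f x X = (\<chi> s. case s of Inl i \<Rightarrow> coad (x $ j1) X $ i | Inr i \<Rightarrow> coad (x $ j2) X $ i)" for x X
  have f: "clinear (f x)" for x
    by (rule clinearI) (auto simp: f_def vec_eq_iff clinear_add[OF clinear_coad] clinear_scale[OF clinear_coad] split: sum.split)
  have lin: "linear (\<lambda>x. f x X)" for X
    by (rule linearI) (auto simp: f_def vec_eq_iff linear_add[OF linear_coad_left] linear_scale[OF linear_coad_left] split: sum.split)
  have ker: "{X. f x X = 0} = stab (x $ j1) \<inter> stab (x $ j2)" for x
    by (auto simp: stab_def f_def vec_eq_iff split_sum_all)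
  \<comment> \<open>\<open>f\<close> reads only the components \<open>j1\<close> and
    \<open>j2\<close>; the remaining ones are filled arbitrarily with \<open>\<xi>2\<close>.\<close>
  define x0 where "x0 = (\<chi> j. if j = j1 then \<xi>1 else \<xi>2)"
  have "{X. f x0 X = 0} \<subseteq> {0}" using \<xi> assms(3) by (simp add: ker x0_def)
  then have "vec.dim {X. f x0 X = 0} = 0" by (simp add: vec.dim_eq_0)
  then obtain D where D: "open D" "closure D = UNIV" "\<And>x. x \<in> D \<Longrightarrow> vec.dim {X. f x X = 0} = 0"
    using kernel_dim_generic[OF f lin, of x0] by (metis le_zero_eq)
  have "(\<Inter>j. stab (x $ j)) = {0}" if "x \<in> D" for x
  proof -
    have "stab (x $ j1) \<inter> stab (x $ j2) \<subseteq> {0}" using D(3)[OF that] unfolding ker by (simp add: vec.dim_eq_0)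
    moreover have "0 \<in> stab (x $ j)" for j using subspace_stab by (rule vec.subspace_0)
    ultimately show ?thesis by blast
  qed
  moreover have "open (D \<inter> (\<Inter>j\<in>UNIV. R j)) \<and> closure (D \<inter> (\<Inter>j\<in>UNIV. R j)) = UNIV"
    using open_dense_INT[OF finite, of UNIV R] R dense_Int[of D "\<Inter>j\<in>UNIV. R j"] D by blast
  ultimately show ?thesis using R(2) by (intro exI[of _ "D \<inter> (\<Inter>j\<in>UNIV. R j)"]) blast
qed

end

section \<open>Derivatives of holomorphic maps of several variables\<close>

text \<open>The scaling is abstract so as to cover both \<open>complex^'n\<close> and products of two such spaces.\<close>

locale complex_scaling =
  fixes sc :: "complex \<Rightarrow> 'a::euclidean_space \<Rightarrow> 'a"
  assumes bilinear_sc: "bounded_bilinear sc" and sc_one: "sc 1 x = x"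
begin

definition cdiff :: "('a \<Rightarrow> complex) \<Rightarrow> 'a \<Rightarrow> bool" where
  "cdiff f x \<longleftrightarrow> (\<exists>D. (f has_derivative D) (at x) \<and> (\<forall>c v. D (sc c v) = c * D v))"

abbreviation fd :: "('a \<Rightarrow> complex) \<Rightarrow> 'a \<Rightarrow> 'a \<Rightarrow> complex" where
  "fd f x \<equiv> frechet_derivative f (at x)"

lemma cdiffD:
  assumes "cdiff f x"
  shows "(f has_derivative fd f x) (at x)" "fd f x (sc c v) = c * fd f x v"
proof -
  obtain D where D: "(f has_derivative D) (at x)" "\<And>c v. D (sc c v) = c * D v"
    using assms by (auto simp: cdiff_def)
  moreover have "D = fd f x" by (rule frechet_derivative_at[OF D(1)])
  ultimately show "(f has_derivative fd f x) (at x)" "fd f x (sc c v) = c * fd f x v" by auto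
qed

lemma cdiff_imp_continuous_on: "(\<And>x. x \<in> S \<Longrightarrow> cdiff f x) \<Longrightarrow> continuous_on S f"
  by (meson cdiffD(1) continuous_at_imp_continuous_on has_derivative_continuous)

lemma line_has_derivative:
  assumes "cdiff f (x + sc c v)"
  shows "((\<lambda>z. f (x + sc z v)) has_field_derivative fd f (x + sc c v) v) (at c)"
proof -
  have "((\<lambda>z. x + sc z v) has_derivative (\<lambda>z. sc z v)) (at c)"
    by (auto intro!: derivative_eq_intros bounded_linear.has_derivative[OF bounded_bilinear.bounded_linear_left[OF bilinear_sc]])
  from has_derivative_compose[OF this cdiffD(1)[OF assms]]
  show ?thesis unfolding has_field_derivative_def
    by (rule has_derivative_eq_rhs) (simp add: fun_eq_iff cdiffD(2)[OF assms])
qed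

text \<open>On the complex line through \<open>x\<close> in direction \<open>v\<close> the function
  is holomorphic in one variable. Cauchy's formula for the derivative has the factor
  \<open>1 / u^2\<close>, and the velocity of the circle is \<open>2 * pi * \<i> * u\<close>, which
  leaves \<open>1 / u\<close>. The derivative is thereby expressed through values of
  \<open>f\<close> alone.\<close>

lemma Cauchy_frechet_derivative:
  assumes cd: "\<And>c. norm c \<le> \<rho> \<Longrightarrow> cdiff f (x + sc c v)" and \<rho>: "\<rho> > 0"
  shows "fd f x v = integral {0..1} (\<lambda>t. f (x + sc (circlepath 0 \<rho> t) v) / circlepath 0 \<rho> t)"
proof -
  define g where "g z = f (x + sc z v)" for z
  have g: "(g has_field_derivative fd f (x + sc c v) v) (at c)" if "norm c \<le> \<rho>" for c
    unfolding g_def by (rule line_has_derivative[OF cd[OF that]])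
  have sc0: "sc 0 v = 0" by (rule bounded_bilinear.zero_left[OF bilinear_sc])
  have deriv: "deriv g 0 = fd f x v"
    using DERIV_imp_deriv[OF g[of 0]] \<rho> by (simp add: sc0)
  have hol: "g holomorphic_on cball 0 \<rho>"
    by (rule holomorphic_onI) (use g in \<open>auto simp: field_differentiable_def intro: has_field_derivative_at_within\<close>)
  have "contour_integral (circlepath 0 \<rho>) (\<lambda>u. g u / (u - 0)^2) = (2 * pi * \<i>) * deriv g 0"
    by (rule Cauchy_contour_integral_circlepath_2)
      (use hol \<rho> in \<open>auto intro: holomorphic_on_imp_continuous_on holomorphic_on_subset\<close>)
  moreover have "contour_integral (circlepath 0 \<rho>) (\<lambda>u. g u / (u - 0)^2)
     = integral {0..1} (\<lambda>t. (2 * pi * \<i>) * (g (circlepath 0 \<rho> t) / circlepath 0 \<rho> t))"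
    unfolding contour_integral_integral
  proof (rule integral_cong)
    fix t :: real assume "t \<in> {0..1}"
    have "circlepath 0 \<rho> t \<noteq> 0" using \<rho> by (simp add: circlepath)
    moreover have "vector_derivative (circlepath 0 \<rho>) (at t) = 2 * pi * \<i> * circlepath 0 \<rho> t"
      unfolding vector_derivative_circlepath by (simp add: circlepath)
    ultimately show "g (circlepath 0 \<rho> t) / (circlepath 0 \<rho> t - 0)\<^sup>2 * vector_derivative (circlepath 0 \<rho>) (at t) =
         complex_of_real (2 * pi) * \<i> * (g (circlepath 0 \<rho> t) / circlepath 0 \<rho> t)"
      by (simp add: power2_eq_square)
  qed
  ultimately have "(2 * pi * \<i>) * integral {0..1} (\<lambda>t. (g (circlepath 0 \<rho> t) / circlepath 0 \<rho> t)) = (2 * pi * \<i>) * fd f x v"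
    unfolding deriv integral_mult_right[symmetric] by metis
  then show ?thesis by (simp add: g_def)
qed

text \<open>One radius \<rho> has to serve all \<open>x\<close> near \<open>x0\<close>, so that
  their derivatives are integrals over the same circle. Half of \<open>e\<close> is reserved for
  \<open>x\<close>, half for the disc.\<close>

lemma uniform_disc:
  assumes "open S" "x0 \<in> S"
  obtains r \<rho> where "r > 0" "\<rho> > 0" "\<And>x c. x \<in> ball x0 r \<Longrightarrow> norm c \<le> \<rho> \<Longrightarrow> x + sc c v \<in> S"
proof -
  obtain e where e: "e > 0" "ball x0 e \<subseteq> S" using assms open_contains_ball by blast
  obtain K where K: "\<And>a b. norm (sc a b) \<le> norm a * norm b * K" "K > 0"
    using bounded_bilinear.pos_bounded[OF bilinear_sc] by blast
  define \<rho> where "\<rho> = e / 2 / (norm v * K + 1)"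
  have pos: "norm v * K + 1 > 0" using K(2) by (simp add: add_nonneg_pos)
  have "x + sc c v \<in> S" if "x \<in> ball x0 (e / 2)" "norm c \<le> \<rho>" for x c
  proof -
    have "norm (sc c v) \<le> norm c * (norm v * K)" using K(1)[of c v] by (simp add: mult.assoc)
    also have "\<dots> \<le> norm c * (norm v * K + 1)" by (intro mult_left_mono) auto
    also have "\<dots> \<le> \<rho> * (norm v * K + 1)" using that pos by (intro mult_right_mono) auto
    also have "\<dots> = e / 2" unfolding \<rho>_def by (rule nonzero_eq_divide_eq[THEN iffD1, OF _ refl]) (use pos in simp)
    finally have "norm (sc c v) \<le> e / 2" .
    moreover have "dist x0 (x + sc c v) \<le> dist x0 x + norm (sc c v)"
      by (metis add_diff_cancel_left' dist_norm dist_triangle norm_minus_commute)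
    ultimately have "x + sc c v \<in> ball x0 e" using that by auto
    then show ?thesis using e by blast
  qed
  moreover have "\<rho> > 0" using e pos by (simp add: \<rho>_def)
  ultimately show ?thesis using that[of "e / 2" \<rho>] e by simp
qed

lemma circlepath_nonzero: "\<rho> > 0 \<Longrightarrow> circlepath 0 \<rho> t \<noteq> 0"
  and norm_circlepath: "\<rho> > 0 \<Longrightarrow> norm (circlepath 0 \<rho> t) = \<rho>"
  and continuous_on_circlepath: "continuous_on X (circlepath 0 \<rho>)"
  by (auto simp: circlepath norm_mult intro!: continuous_intros)

lemma continuous_on_shifted_circle:
  assumes S: "\<And>x c. x \<in> X \<Longrightarrow> norm c \<le> \<rho> \<Longrightarrow> x + sc c v \<in> S" and \<rho>: "\<rho> > 0" and h: "continuous_on S h"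
  shows "continuous_on (X \<times> cbox 0 1) (\<lambda>(x, t). h (x + sc (circlepath 0 \<rho> t) v) / circlepath 0 \<rho> t)"
proof -
  have c: "continuous_on (X \<times> cbox 0 1) (\<lambda>p. circlepath 0 \<rho> (snd p))"
    by (intro continuous_on_compose2[OF continuous_on_circlepath[of UNIV]] continuous_intros) auto
  have "continuous_on (X \<times> cbox 0 1) (\<lambda>p. fst p + sc (circlepath 0 \<rho> (snd p)) v)"
    by (intro continuous_intros bounded_linear.continuous_on[OF bounded_bilinear.bounded_linear_left[OF bilinear_sc]] c)
  then have "continuous_on (X \<times> cbox 0 1) (\<lambda>p. h (fst p + sc (circlepath 0 \<rho> (snd p)) v))"
    by (rule continuous_on_compose2[OF h]) (auto intro!: S simp: norm_circlepath \<rho>)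
  then show ?thesis unfolding split_beta
    by (intro continuous_on_divide c) (auto simp: circlepath_nonzero \<rho>)
qed

text \<open>By Cauchy's formula the derivative is locally an integral of a continuous integrand with
  parameter \<open>x\<close>.\<close>

lemma continuous_on_frechet_derivative:
  assumes "open S" and cd: "\<And>x. x \<in> S \<Longrightarrow> cdiff f x"
  shows "continuous_on S (\<lambda>x. fd f x v)"
proof (rule continuous_at_imp_continuous_on, rule ballI)
  fix x0 assume "x0 \<in> S"
  then obtain r \<rho> where r: "r > 0" "\<rho> > 0" "\<And>x c. x \<in> ball x0 r \<Longrightarrow> norm c \<le> \<rho> \<Longrightarrow> x + sc c v \<in> S"
    using uniform_disc[OF assms(1)] by metis
  have "continuous_on (ball x0 r) (\<lambda>x. integral (cbox 0 1) (\<lambda>t. f (x + sc (circlepath 0 \<rho> t) v) / circlepath 0 \<rho> t))"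
    by (intro integral_continuous_on_param continuous_on_shifted_circle[where S=S] r cdiff_imp_continuous_on cd) auto
  moreover have "integral (cbox 0 1) (\<lambda>t. f (x + sc (circlepath 0 \<rho> t) v) / circlepath 0 \<rho> t) = fd f x v"
    if "x \<in> ball x0 r" for x
    using Cauchy_frechet_derivative[of \<rho> f x v] r that cd by (simp add: cbox_interval)
  ultimately have "continuous_on (ball x0 r) (\<lambda>x. fd f x v)"
    by (rule continuous_on_eq)
  then show "isCont (\<lambda>x. fd f x v) x0"
    using r(1) by (simp add: continuous_on_eq_continuous_at)
qed

text \<open>Differentiation under Cauchy's integral: the integrand has a continuous derivative by
  \<open>continuous_on_frechet_derivative\<close>, and complex linearity passes from the integrand
  to the integral.\<close>

theorem cdiff_frechet_derivative:
  assumes "open S" and cd: "\<And>x. x \<in> S \<Longrightarrow> cdiff f x" and x0: "x0 \<in> S"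
  shows "cdiff (\<lambda>x. fd f x v) x0"
proof -
  obtain r \<rho> where r: "r > 0" "\<rho> > 0" "\<And>x c. x \<in> ball x0 r \<Longrightarrow> norm c \<le> \<rho> \<Longrightarrow> x + sc c v \<in> S"
    using uniform_disc[OF assms(1) x0] by metis
  define e where "e = circlepath 0 \<rho>"
  have e: "e t \<noteq> 0" "norm (e t) \<le> \<rho>" for t using r(2) by (auto simp: e_def circlepath_nonzero norm_circlepath)
  \<comment> \<open>The Leibniz rule for parameter integrals takes a derivative with values in
    bounded linear maps; its continuity is then checked on basis vectors.\<close>
  define fx where "fx x t = Blinfun (\<lambda>w. fd f (x + sc (e t) v) w / e t)" for x t
  have D: "((\<lambda>x. f (x + sc (e t) v) / e t) has_derivative (\<lambda>w. fd f (x + sc (e t) v) w / e t)) (at x)"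
    if "x \<in> ball x0 r" for x t
  proof -
    have "((\<lambda>x. f (x + sc (e t) v)) has_derivative fd f (x + sc (e t) v)) (at x)"
    proof (rule has_derivative_compose[where f = "\<lambda>x. x + sc (e t) v" and f' = "\<lambda>w. w" and g' = "fd f (x + sc (e t) v)"])
      show "((\<lambda>x. x + sc (e t) v) has_derivative (\<lambda>w. w)) (at x)"
        by (auto intro!: derivative_eq_intros)
      show "(f has_derivative fd f (x + sc (e t) v)) (at (x + sc (e t) v))"
        by (rule cdiffD(1)[OF cd[OF r(3)[OF that e(2)]]])
    qed
    from bounded_linear.has_derivative[OF bounded_linear_divide this]
    show ?thesis .
  qed
  have fx: "blinfun_apply (fx x t) w = fd f (x + sc (e t) v) w / e t" if "x \<in> ball x0 r" for x t w
    unfolding fx_def using has_derivative_bounded_linear[OF D[OF that]] by (simp add: bounded_linear_Blinfun_apply)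
  have cont_fx: "continuous_on (ball x0 r \<times> cbox 0 1) (\<lambda>(x, t). fx x t)"
  proof (rule continuous_on_blinfun_componentwise)
    fix i :: 'a
    have "continuous_on (ball x0 r \<times> cbox 0 1) (\<lambda>(x, t). fd f (x + sc (e t) v) i / e t)"
      unfolding e_def
      by (rule continuous_on_shifted_circle[OF r(3) r(2) continuous_on_frechet_derivative[OF assms(1) cd]])
    then show "continuous_on (ball x0 r \<times> cbox 0 1) (\<lambda>x. blinfun_apply (case x of (x, t) \<Rightarrow> fx x t) i)"
      by (rule continuous_on_eq) (auto simp: fx)
  qed
  have cont_f: "continuous_on (ball x0 r \<times> cbox 0 1) (\<lambda>(x, t). f (x + sc (e t) v) / e t)"
    unfolding e_def
    by (rule continuous_on_shifted_circle[OF r(3) r(2) cdiff_imp_continuous_on[OF cd]])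
  have "continuous_on (cbox 0 1) (\<lambda>t. f (x + sc (e t) v) / e t)" if "x \<in> ball x0 r" for x
    using continuous_on_compose2[OF cont_f continuous_on_Pair[OF continuous_on_const continuous_on_id], of x "cbox 0 1"] that
    by (simp add: image_subset_iff)
  then have "((\<lambda>x. integral (cbox 0 1) (\<lambda>t. f (x + sc (e t) v) / e t)) has_derivative
      integral (cbox 0 1) (fx x0)) (at x0 within ball x0 r)"
  proof (intro leibniz_rule[OF _ _ cont_fx] integrable_continuous)
    fix x t assume x: "x \<in> ball x0 r"
    have "blinfun_apply (fx x t) = (\<lambda>w. fd f (x + sc (e t) v) w / e t)" by (simp add: fun_eq_iff fx[OF x])
    then show "((\<lambda>x. f (x + sc (e t) v) / e t) has_derivative blinfun_apply (fx x t)) (at x within ball x0 r)"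
      using has_derivative_at_withinI[OF D[OF x]] by simp
  qed (use r(1) in auto)
  moreover have "at x0 within ball x0 r = at x0"
    using r(1) by (intro at_within_open) auto
  ultimately have "((\<lambda>x. integral (cbox 0 1) (\<lambda>t. f (x + sc (e t) v) / e t)) has_derivative
      integral (cbox 0 1) (fx x0)) (at x0)"
    by (simp only:)
  then have H: "((\<lambda>x. fd f x v) has_derivative integral (cbox 0 1) (fx x0)) (at x0)"
  proof (rule has_derivative_transform_within_open)
    fix x assume x: "x \<in> ball x0 r"
    have "fd f x v = integral {0..1} (\<lambda>t. f (x + sc (circlepath 0 \<rho> t) v) / circlepath 0 \<rho> t)"
      by (rule Cauchy_frechet_derivative[OF cd[OF r(3)[OF x]] r(2)])
    then show "integral (cbox 0 1) (\<lambda>t. f (x + sc (e t) v) / e t) = fd f x v"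
      by (simp add: cbox_interval e_def)
  qed (use r(1) in auto)
  have "continuous_on (cbox 0 1) (fx x0)"
    using continuous_on_compose2[OF cont_fx continuous_on_Pair[OF continuous_on_const continuous_on_id], of x0 "cbox 0 1"] r(1)
    by (simp add: image_subset_iff)
  then have int: "fx x0 integrable_on cbox 0 1" by (rule integrable_continuous)
  have "blinfun_apply (integral (cbox 0 1) (fx x0)) (sc c w) = c * blinfun_apply (integral (cbox 0 1) (fx x0)) w" for c w
  proof -
    have "blinfun_apply (fx x0 t) (sc c w) = c * blinfun_apply (fx x0 t) w" for t
    proof -
      have x0: "x0 \<in> ball x0 r" using r(1) by simp
      show ?thesis unfolding fx[OF x0] cdiffD(2)[OF cd[OF r(3)[OF x0 e(2)]]] by simp
    qed
    then show ?thesis unfolding blinfun_apply_integral[OF int] by simp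
  qed
  with H show ?thesis unfolding cdiff_def by blast
qed

end

section \<open>The complex structures on vectors and pairs, and the chain rule\<close>

lemma bounded_bilinear_smult: "bounded_bilinear ((*s) :: complex \<Rightarrow> complex^'n \<Rightarrow> complex^'n)"
proof
  show "\<exists>K. \<forall>a (b :: complex^'n). norm (a *s b) \<le> norm a * norm b * K"
    by (rule exI[of _ 1]) (simp add: norm_smult)
qed (simp_all add: vec_eq_iff distrib_left distrib_right)

interpretation smult: complex_scaling "(*s) :: complex \<Rightarrow> complex^'n \<Rightarrow> complex^'n"
  by (rule complex_scaling.intro[OF bounded_bilinear_smult]) simp

definition pair_smult :: "complex \<Rightarrow> (complex^'n) \<times> (complex^'k) \<Rightarrow> (complex^'n) \<times> (complex^'k)" where
  "pair_smult c p = (c *s fst p, c *s snd p)"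

lemma norm_pair_smult: "norm (pair_smult c p) = norm c * norm p"
proof -
  have "(norm c * a)\<^sup>2 + (norm c * b)\<^sup>2 = (norm c)\<^sup>2 * (a\<^sup>2 + b\<^sup>2)" for a b :: real
    by (simp add: power_mult_distrib distrib_left)
  then show ?thesis
    by (simp add: pair_smult_def norm_prod_def norm_smult real_sqrt_mult)
qed

interpretation pair_smult: complex_scaling pair_smult
proof unfold_locales
  show "\<exists>K. \<forall>a (b :: (complex^'n) \<times> (complex^'k)). norm (pair_smult a b) \<le> norm a * norm b * K"
    by (rule exI[of _ 1]) (simp add: norm_pair_smult)
qed (simp_all add: pair_smult_def vec_eq_iff distrib_left distrib_right prod_eq_iff)

lemma has_derivative_vec_iff:
  fixes f :: "'a::real_normed_vector \<Rightarrow> 'b::euclidean_space^'m"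
  shows "(f has_derivative D) (at x) \<longleftrightarrow> (\<forall>i. ((\<lambda>y. f y $ i) has_derivative (\<lambda>v. D v $ i)) (at x))"
proof
  assume "(f has_derivative D) (at x)"
  then show "\<forall>i. ((\<lambda>y. f y $ i) has_derivative (\<lambda>v. D v $ i)) (at x)"
    by (auto intro!: bounded_linear.has_derivative[OF bounded_linear_vec_nth])
next
  assume *: "\<forall>i. ((\<lambda>y. f y $ i) has_derivative (\<lambda>v. D v $ i)) (at x)"
  show "(f has_derivative D) (at x)"
    unfolding has_derivative_componentwise_within[of f]
  proof
    fix b :: "'b^'m" assume "b \<in> Basis"
    then obtain i u where b: "b = axis i u" by (auto simp: Basis_vec_def)
    show "((\<lambda>x. f x \<bullet> b) has_derivative (\<lambda>x. D x \<bullet> b)) (at x)"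
      unfolding b inner_axis using * by (intro has_derivative_inner_left) blast
  qed
qed

lemma cdifferentiable_at_iff: "cdifferentiable_at f x \<longleftrightarrow> (\<forall>i. smult.cdiff (\<lambda>y. f y $ i) x)"
proof
  assume "\<forall>i. smult.cdiff (\<lambda>y. f y $ i) x"
  then obtain D where "\<And>i. ((\<lambda>y. f y $ i) has_derivative D i) (at x)" "\<And>i c v. D i (c *s v) = c * D i v"
    unfolding smult.cdiff_def by metis
  then show "cdifferentiable_at f x"
    unfolding cdifferentiable_at_def has_derivative_vec_iff
    by (intro exI[of _ "\<lambda>v. \<chi> i. D i v"]) (simp add: vec_eq_iff)
next
  assume "cdifferentiable_at f x"
  then obtain D where D: "\<And>i. ((\<lambda>y. f y $ i) has_derivative (\<lambda>v. D v $ i)) (at x)" "\<And>c v. D (c *s v) = c *s D v"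
    unfolding cdifferentiable_at_def has_derivative_vec_iff by blast
  show "\<forall>i. smult.cdiff (\<lambda>y. f y $ i) x"
    unfolding smult.cdiff_def
    by (intro allI exI conjI, rule D(1)) (simp add: D(2))
qed

lemma cdifferentiable2_at_iff: "cdifferentiable2_at f x \<longleftrightarrow> (\<forall>i. pair_smult.cdiff (\<lambda>y. f y $ i) x)"
proof
  assume "\<forall>i. pair_smult.cdiff (\<lambda>y. f y $ i) x"
  then obtain D where D: "\<And>i. ((\<lambda>y. f y $ i) has_derivative D i) (at x)" "\<And>i c v. D i (pair_smult c v) = c * D i v"
    unfolding pair_smult.cdiff_def by metis
  have "D i (c *s u, c *s v) = c * D i (u, v)" for i c u v
    using D(2)[of i c "(u, v)"] by (simp add: pair_smult_def)
  with D(1)  show "cdifferentiable2_at f x"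
    unfolding cdifferentiable2_at_def has_derivative_vec_iff
    by (intro exI[of _ "\<lambda>v. \<chi> i. D i v"]) (simp add: vec_eq_iff)
next
  assume "cdifferentiable2_at f x"
  then obtain D where D: "\<And>i. ((\<lambda>y. f y $ i) has_derivative (\<lambda>v. D v $ i)) (at x)" "\<And>c u v. D (c *s u, c *s v) = c *s D (u, v)"
    unfolding cdifferentiable2_at_def has_derivative_vec_iff by blast
  show "\<forall>i. pair_smult.cdiff (\<lambda>y. f y $ i) x"
    unfolding pair_smult.cdiff_def
    by (intro allI exI conjI, rule D(1)) (simp add: D(2) pair_smult_def)
qed

abbreviation FD :: "('a::real_normed_vector \<Rightarrow> 'b::real_normed_vector) \<Rightarrow> 'a \<Rightarrow> 'a \<Rightarrow> 'b" where
  "FD f x \<equiv> frechet_derivative f (at x)"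

lemma cdifferentiable_atD:
  assumes "cdifferentiable_at f x"
  shows "(f has_derivative FD f x) (at x)" "clinear (FD f x)"
proof -
  obtain D where D: "(f has_derivative D) (at x)" "\<And>c v. D (c *s v) = c *s D v"
    using assms by (auto simp: cdifferentiable_at_def)
  have "D = FD f x" by (rule frechet_derivative_at[OF D(1)])
  with D show "(f has_derivative FD f x) (at x)" by simp
  show "clinear (FD f x)"
    unfolding \<open>D = FD f x\<close>[symmetric] using D has_derivative_linear[OF D(1)] by (intro clinearI) (auto simp: linear_add)
qed

lemma cdifferentiable2_atD:
  assumes "cdifferentiable2_at f x"
  shows "(f has_derivative FD f x) (at x)" "FD f x (c *s u, c *s v) = c *s FD f x (u, v)"
proof -
  obtain D where D: "(f has_derivative D) (at x)" "\<And>c u v. D (c *s u, c *s v) = c *s D (u, v)"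
    using assms by (auto simp: cdifferentiable2_at_def)
  have "D = FD f x" by (rule frechet_derivative_at[OF D(1)])
  with D show "(f has_derivative FD f x) (at x)" "FD f x (c *s u, c *s v) = c *s FD f x (u, v)" by auto
qed

lemma cdifferentiable_atI:
  "(f has_derivative D) (at x) \<Longrightarrow> (\<And>c v. D (c *s v) = c *s D v) \<Longrightarrow> cdifferentiable_at f x"
  unfolding cdifferentiable_at_def by blast

lemma cdifferentiable_at_compose:
  assumes g: "cdifferentiable_at g x" and f: "cdifferentiable_at f (g x)"
  shows "cdifferentiable_at (\<lambda>y. f (g y)) x" "FD (\<lambda>y. f (g y)) x v = FD f (g x) (FD g x v)"
proof -
  have *: "((\<lambda>y. f (g y)) has_derivative (\<lambda>v. FD f (g x) (FD g x v))) (at x)"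
    by (rule has_derivative_compose[OF cdifferentiable_atD(1)[OF g] cdifferentiable_atD(1)[OF f]])
  then show "cdifferentiable_at (\<lambda>y. f (g y)) x"
    by (rule cdifferentiable_atI) (simp add: clinear_scale[OF cdifferentiable_atD(2)[OF g]] clinear_scale[OF cdifferentiable_atD(2)[OF f]])
  show "FD (\<lambda>y. f (g y)) x v = FD f (g x) (FD g x v)"
    using fun_cong[OF frechet_derivative_at[OF *], of v] by simp
qed

lemma cdifferentiable_at_Pair_compose:
  assumes g: "cdifferentiable_at g x" and h: "cdifferentiable_at h x" and f: "cdifferentiable2_at f (g x, h x)"
  shows "cdifferentiable_at (\<lambda>y. f (g y, h y)) x" "FD (\<lambda>y. f (g y, h y)) x v = FD f (g x, h x) (FD g x v, FD h x v)"
proof -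
  have "((\<lambda>y. (g y, h y)) has_derivative (\<lambda>v. (FD g x v, FD h x v))) (at x)"
    by (intro has_derivative_Pair cdifferentiable_atD assms)
  from has_derivative_compose[OF this, of f] cdifferentiable2_atD(1)[OF f]
  have *: "((\<lambda>y. f (g y, h y)) has_derivative (\<lambda>v. FD f (g x, h x) (FD g x v, FD h x v))) (at x)"
    by blast
  then show "cdifferentiable_at (\<lambda>y. f (g y, h y)) x"
    by (rule cdifferentiable_atI) (simp add: clinear_scale[OF cdifferentiable_atD(2)[OF g]] clinear_scale[OF cdifferentiable_atD(2)[OF h]]
         cdifferentiable2_atD(2)[OF f])
  show "FD (\<lambda>y. f (g y, h y)) x v = FD f (g x, h x) (FD g x v, FD h x v)"
    using fun_cong[OF frechet_derivative_at[OF *], of v] by simp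
qed

lemma cdifferentiable_at_const: "cdifferentiable_at (\<lambda>y. a) x"
  and cdifferentiable_at_id: "cdifferentiable_at (\<lambda>y. y) x"
  by (rule cdifferentiable_atI, rule derivative_intros, simp)+

lemma cdifferentiable_at_cong:
  assumes "eventually (\<lambda>y. f y = g y) (nhds x)" "cdifferentiable_at f x"
  shows "cdifferentiable_at g x" "FD g x = FD f x"
proof -
  have "eventually (\<lambda>y. f y = g y) (at x)" "f x = g x"
    using assms(1) by (auto simp: eventually_nhds_conv_at)
  then have *: "(g has_derivative FD f x) (at x)"
    using has_derivative_transform_eventually[OF cdifferentiable_atD(1)[OF assms(2)]] by simp
  then show "cdifferentiable_at g x"
    by (rule cdifferentiable_atI) (simp add: clinear_scale[OF cdifferentiable_atD(2)[OF assms(2)]])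
  show "FD g x = FD f x" using frechet_derivative_at[OF *] by simp
qed

lemma FD_component:
  fixes f :: "'a::real_normed_vector \<Rightarrow> complex^'m"
  assumes "f differentiable (at x)"
  shows "FD f x v $ i = FD (\<lambda>y. f y $ i) x v"
proof -
  have "((\<lambda>y. f y $ i) has_derivative (\<lambda>v. FD f x v $ i)) (at x)"
    using assms frechet_derivative_works has_derivative_vec_iff[of f "FD f x" x] by blast
  from fun_cong[OF frechet_derivative_at[OF this], of v] show ?thesis by simp
qed

lemma continuous_on_FD:
  assumes "open S" and cd: "\<And>x. x \<in> S \<Longrightarrow> cdifferentiable_at f x"
  shows "continuous_on S (\<lambda>x. FD f x v)"
proof -
  have "continuous_on S (\<lambda>x. FD (\<lambda>y. f y $ i) x v)" for i
    by (rule smult.continuous_on_frechet_derivative) (use assms in \<open>auto simp: cdifferentiable_at_iff\<close>)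
  moreover have "FD f x v = (\<chi> i. FD (\<lambda>y. f y $ i) x v)" if "x \<in> S" for x
    using FD_component[OF differentiableI[OF cdifferentiable_atD(1)[OF cd[OF that]]]] by (simp add: vec_eq_iff)
  ultimately show ?thesis by (simp add: continuous_on_vec_lambda cong: continuous_on_cong)
qed

text \<open>Meant for conjugation as a function of both group elements: its partial derivative in
  the conjugated element is \<open>Ad\<close>, and holomorphy of that in the other element lets the
  bracket exist as a derivative.\<close>

lemma cdifferentiable_at_partial_FD:
  fixes f :: "(complex^'n) \<times> (complex^'k) \<Rightarrow> complex^'m"
  assumes "open S" and cd: "\<And>x. x \<in> S \<Longrightarrow> cdifferentiable2_at f x" and x0: "(x0, y0) \<in> S"
  shows "cdifferentiable_at (\<lambda>x. FD f (x, y0) (0, v)) x0"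
proof (rule cdifferentiable_at_cong)
  have "pair_smult.cdiff (\<lambda>p. FD (\<lambda>y. f y $ i) p (0, v)) (x0, y0)" for i
    by (rule pair_smult.cdiff_frechet_derivative[OF assms(1) _ x0])
      (use cd in \<open>simp add: cdifferentiable2_at_iff\<close>)
  then have "cdifferentiable2_at (\<lambda>p. (\<chi> i. FD (\<lambda>y. f y $ i) p (0, v))) (x0, y0)"
    by (simp add: cdifferentiable2_at_iff)
  then show "cdifferentiable_at (\<lambda>x. (\<chi> i. FD (\<lambda>y. f y $ i) (x, y0) (0, v))) x0"
    by (rule cdifferentiable_at_Pair_compose(1)[where f = "\<lambda>p. (\<chi> i. FD (\<lambda>y. f y $ i) p (0, v))",
        OF cdifferentiable_at_id cdifferentiable_at_const])
  have "open ((\<lambda>x. (x, y0)) -` S)"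
    by (intro open_vimage assms(1)) (auto intro!: continuous_intros)
  then have "eventually (\<lambda>x. x \<in> (\<lambda>x. (x, y0)) -` S) (nhds x0)"
    using x0 by (intro eventually_nhds_in_open) auto
  then have "eventually (\<lambda>x. (x, y0) \<in> S) (nhds x0)"
    by simp
  then show "eventually (\<lambda>x. (\<chi> i. FD (\<lambda>y. f y $ i) (x, y0) (0, v)) = FD f (x, y0) (0, v)) (nhds x0)"
  proof (rule eventually_mono)
    fix x assume "(x, y0) \<in> S"
    then have "f differentiable (at (x, y0))"
      by (intro differentiableI[OF cdifferentiable2_atD(1)[OF cd]])
    then show "(\<chi> i. FD (\<lambda>y. f y $ i) (x, y0) (0, v)) = FD f (x, y0) (0, v)"
      by (simp add: vec_eq_iff FD_component)
  qed
qed

lemma clinear_cdifferentiable: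
  assumes "clinear L"
  shows "cdifferentiable_at L x" "FD L x = L"
proof -
  have *: "(L has_derivative L) (at x)"
    by (rule bounded_linear_imp_has_derivative[OF clinear_imp_bounded_linear[OF assms]])
  then show "cdifferentiable_at L x" by (rule cdifferentiable_atI) (simp add: clinear_scale[OF assms])
  show "FD L x = L" using frechet_derivative_at[OF *] by simp
qed

lemma FD_ident: "FD (\<lambda>y. y) x v = v"
  and FD_const: "FD (\<lambda>y. c) x v = 0"
  using frechet_derivative_at[OF has_derivative_ident, of x] frechet_derivative_at[OF has_derivative_const, of c x] by metis+

text \<open>With \<open>q\<close> a projection onto \<open>V\<close>, the linear map
  \<open>z - q z\<close> annihilates \<open>f\<close> near \<open>x\<close>, hence also its
  derivative. This turns invariance under \<open>Ad\<close> into invariance under the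
  bracket.\<close>

lemma FD_in_subspace:
  assumes f: "cdifferentiable_at f x" and V: "vec.subspace V" and ev: "eventually (\<lambda>y. f y \<in> V) (nhds x)"
  shows "FD f x v \<in> V"
proof -
  obtain q where q: "clinear q" "range q \<subseteq> V" "\<And>z. z \<in> V \<Longrightarrow> q z = z"
    using exists_projection[OF V] by metis
  define L where "L z = z - q z" for z
  have L: "clinear L"
    by (rule clinearI) (auto simp: L_def clinear_add[OF q(1)] clinear_scale[OF q(1)] vec.scale_right_diff_distrib)
  have "eventually (\<lambda>y. 0 = L (f y)) (nhds x)"
    using ev by (rule eventually_mono) (simp add: L_def q(3))
  from cdifferentiable_at_cong(2)[OF this cdifferentiable_at_const]
  have "FD (\<lambda>y. L (f y)) x v = 0"
    by (simp add: FD_const)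
  then have "L (FD f x v) = 0"
    using cdifferentiable_at_compose(2)[OF f clinear_cdifferentiable(1)[OF L]] by (simp add: clinear_cdifferentiable(2)[OF L])
  then have "FD f x v = q (FD f x v)" by (simp add: L_def)
  then show ?thesis using q(2) by (metis range_subsetD)
qed

section \<open>The adjoint action in a chart around the unit\<close>

context complex_lie_group
begin

lemma chart_facts:
  assumes "(V, \<theta>) \<in> A"
  shows "openin T V" "V \<subseteq> carrier G" "open (\<theta> ` V)" "inj_on \<theta> V"
    "homeomorphic_map (subtopology T V) (top_of_set (\<theta> ` V)) \<theta>"
proof -
  show 1: "openin T V" "open (\<theta> ` V)"
    and hom: "homeomorphic_map (subtopology T V) (top_of_set (\<theta> ` V)) \<theta>"
    using chart[OF assms] by auto
  show "V \<subseteq> carrier G" using openin_subset[OF 1(1)] topspace_eq by simp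
  have "topspace (subtopology T V) = V" using openin_subset[OF 1(1)] by auto
  then show "inj_on \<theta> V" using homeomorphic_imp_injective_map[OF hom] by simp
qed

lemma open_chart_image:
  assumes c: "(V, \<theta>) \<in> A" and W: "openin T W"
  shows "open (\<theta> ` (V \<inter> W))"
proof -
  have "openin (subtopology T V) (V \<inter> W)" using W by (auto simp: openin_subtopology)
  then have "openin (top_of_set (\<theta> ` V)) (\<theta> ` (V \<inter> W))"
    using homeomorphic_imp_open_map[OF chart_facts(5)[OF c]] unfolding open_map_def by blast
  then show ?thesis using chart_facts(3)[OF c] by (metis openin_open_trans)
qed

lemma openin_chart_preimage:
  assumes c: "(V, \<theta>) \<in> A" and N: "open N"
  shows "openin T {g \<in> V. \<theta> g \<in> N}"
proof -
  have "continuous_map (subtopology T V) euclidean \<theta>"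
    using homeomorphic_imp_continuous_map[OF chart_facts(5)[OF c]] continuous_map_in_subtopology by blast
  then have "openin (subtopology T V) {g \<in> topspace (subtopology T V). \<theta> g \<in> N}"
    using N by (intro openin_continuous_map_preimage) auto
  moreover have "topspace (subtopology T V) = V" using openin_subset[OF chart_facts(1)[OF c]] by auto
  ultimately have "openin (subtopology T V) {g \<in> V. \<theta> g \<in> N}" by (simp only:)
  then show ?thesis using openin_trans_full chart_facts(1)[OF c] by blast
qed

lemma eventually_chart:
  assumes c: "(V, \<theta>) \<in> A" and g: "g \<in> V" and W: "openin T W" "g \<in> W"
  shows "eventually (\<lambda>y. y \<in> \<theta> ` V \<and> inv_into V \<theta> y \<in> W) (nhds (\<theta> g))"
proof -
  have "eventually (\<lambda>y. y \<in> \<theta> ` (V \<inter> W)) (nhds (\<theta> g))"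
    using g W by (intro eventually_nhds_in_open open_chart_image[OF c]) auto
  then show ?thesis
    by (rule eventually_mono) (auto simp: inv_into_f_f[OF chart_facts(4)[OF c]])
qed

lemma exists_chart: "g \<in> carrier G \<Longrightarrow> \<exists>V \<theta>. (V, \<theta>) \<in> A \<and> g \<in> V"
  using atlas_cover by blast

lemma openin_left_translation:
  assumes "openin T W" "g \<in> carrier G"
  shows "openin T {x \<in> carrier G. g \<otimes> x \<in> W}"
proof -
  have "continuous_map T (prod_topology T T) (\<lambda>x. (g, x))"
    using assms(2) topspace_eq by (intro continuous_map_pairedI) auto
  from continuous_map_compose[OF this mult_continuous]
  have "continuous_map T T (\<lambda>x. g \<otimes> x)" by (simp add: o_def)
  from openin_continuous_map_preimage[OF this assms(1)] show ?thesis by (simp add: topspace_eq)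
qed

lemma openin_right_translation:
  assumes "openin T W" "g \<in> carrier G"
  shows "openin T {x \<in> carrier G. x \<otimes> g \<in> W}"
proof -
  have "continuous_map T (prod_topology T T) (\<lambda>x. (x, g))"
    using assms(2) topspace_eq by (intro continuous_map_pairedI) auto
  from continuous_map_compose[OF this mult_continuous]
  have "continuous_map T T (\<lambda>x. x \<otimes> g)" by (simp add: o_def)
  from openin_continuous_map_preimage[OF this assms(1)] show ?thesis by (simp add: topspace_eq)
qed

lemma left_translation_holomorphic:
  assumes V: "(V, \<theta>) \<in> A" and W: "(W, \<omega>) \<in> A" and a: "a \<in> V" and g: "g \<in> carrier G" and ga: "g \<otimes> a \<in> W"
  shows "cdifferentiable_at (\<lambda>y. \<omega> (g \<otimes> inv_into V \<theta> y)) (\<theta> a)"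
proof -
  obtain V' \<theta>' where V': "(V', \<theta>') \<in> A" "g \<in> V'" using exists_chart[OF g] by blast
  have "cdifferentiable_at (\<lambda>y. (\<lambda>(y, z). \<omega> (inv_into V' \<theta>' y \<otimes> inv_into V \<theta> z)) (\<theta>' g, y)) (\<theta> a)"
    by (rule cdifferentiable_at_Pair_compose(1)[OF cdifferentiable_at_const cdifferentiable_at_id])
      (rule mult_holomorphic[OF V'(1) V W V'(2) a ga])
  then show ?thesis by (simp add: inv_into_f_f[OF chart_facts(4)[OF V'(1)] V'(2)])
qed

lemma right_translation_holomorphic:
  assumes V: "(V, \<theta>) \<in> A" and W: "(W, \<omega>) \<in> A" and a: "a \<in> V" and g: "g \<in> carrier G" and ga: "a \<otimes> g \<in> W"
  shows "cdifferentiable_at (\<lambda>y. \<omega> (inv_into V \<theta> y \<otimes> g)) (\<theta> a)"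
proof -
  obtain V' \<theta>' where V': "(V', \<theta>') \<in> A" "g \<in> V'" using exists_chart[OF g] by blast
  have "cdifferentiable_at (\<lambda>y. (\<lambda>(y, z). \<omega> (inv_into V \<theta> y \<otimes> inv_into V' \<theta>' z)) (y, \<theta>' g)) (\<theta> a)"
    by (rule cdifferentiable_at_Pair_compose(1)[OF cdifferentiable_at_id cdifferentiable_at_const])
      (rule mult_holomorphic[OF V V'(1) W a V'(2) ga])
  then show ?thesis by (simp add: inv_into_f_f[OF chart_facts(4)[OF V'(1)] V'(2)])
qed

end

locale lie_group_chart = complex_lie_group G T A
  for G :: "('g, 'b) monoid_scheme" (structure) and T :: "'g topology"
    and A :: "('g set \<times> ('g \<Rightarrow> complex^'n)) set" +
  fixes U :: "'g set" and \<phi> :: "'g \<Rightarrow> complex^'n"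
  assumes U: "(U, \<phi>) \<in> A" and one_U: "\<one> \<in> U"
begin

abbreviation \<psi> :: "complex^'n \<Rightarrow> 'g" where "\<psi> \<equiv> inv_into U \<phi>"
abbreviation P :: "(complex^'n) set" where "P \<equiv> \<phi> ` U"
abbreviation p :: "complex^'n" where "p \<equiv> \<phi> \<one>"
abbreviation ad_hom :: "'g \<Rightarrow> complex^'n \<Rightarrow> complex^'n" where "ad_hom \<equiv> Ad G U \<phi>"
abbreviation br :: "complex^'n \<Rightarrow> complex^'n \<Rightarrow> complex^'n" where "br \<equiv> bracket G U \<phi>"

definition conj_map :: "'g \<Rightarrow> complex^'n \<Rightarrow> complex^'n" where
  "conj_map g y = \<phi> (g \<otimes> \<psi> y \<otimes> inv g)"

lemma Ad_eq: "ad_hom g = FD (conj_map g) p"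
  by (simp add: Ad_def conj_map_def[abs_def])

lemma \<psi>_\<phi>: "g \<in> U \<Longrightarrow> \<psi> (\<phi> g) = g"
  by (rule inv_into_f_f[OF chart_facts(4)[OF U]])

lemma U_carrier: "g \<in> U \<Longrightarrow> g \<in> carrier G"
  using chart_facts(2)[OF U] by blast

lemma \<psi>_U: "y \<in> P \<Longrightarrow> \<psi> y \<in> U"
  by (rule inv_into_into)

lemma \<phi>_\<psi>: "y \<in> P \<Longrightarrow> \<phi> (\<psi> y) = y"
  by (rule f_inv_into_f)

lemma \<psi>_carrier: "y \<in> P \<Longrightarrow> \<psi> y \<in> carrier G"
  using \<psi>_U U_carrier by blast

lemma p_P: "p \<in> P" using one_U by blast

lemma \<psi>_p: "\<psi> p = \<one>" using \<psi>_\<phi>[OF one_U] .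

lemma open_P: "open P" by (rule chart_facts(3)[OF U])

lemma eventually_P: "y \<in> P \<Longrightarrow> eventually (\<lambda>y. y \<in> P) (nhds y)"
  using open_P by (rule eventually_nhds_in_open)

lemma eventually_\<psi>:
  assumes "y0 \<in> P" "openin T W" "\<psi> y0 \<in> W"
  shows "eventually (\<lambda>y. y \<in> P \<and> \<psi> y \<in> W) (nhds y0)"
  using eventually_chart[OF U \<psi>_U[OF assms(1)] assms(2,3)] by (simp add: \<phi>_\<psi>[OF assms(1)])

lemma openin_conj:
  assumes "openin T W" "g \<in> carrier G"
  shows "openin T {x \<in> carrier G. g \<otimes> x \<otimes> inv g \<in> W}"
proof -
  have "openin T {x \<in> carrier G. g \<otimes> x \<in> {x \<in> carrier G. x \<otimes> inv g \<in> W}}"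
    by (intro openin_left_translation openin_right_translation assms inv_closed)
  then show ?thesis using assms(2) by (simp cong: conj_cong)
qed

lemma eventually_conj:
  assumes "g \<in> carrier G"
  shows "eventually (\<lambda>y. y \<in> P \<and> g \<otimes> \<psi> y \<otimes> inv g \<in> U) (nhds p)"
  using eventually_\<psi>[OF p_P openin_conj[OF chart_facts(1)[OF U] assms]] assms one_U
  by (auto simp: \<psi>_p elim!: eventually_mono)

lemma conj_map_p: "g \<in> carrier G \<Longrightarrow> conj_map g p = p"
  by (simp add: conj_map_def \<psi>_p)

text \<open>Since \<open>g\<close> may lie outside \<open>U\<close>, conjugation is factored through
  a chart around \<open>g\<close>: left translation leads from the unit to \<open>g\<close>, and
  right translation by \<open>inv g\<close> leads back.\<close>

lemma conj_map_holomorphic: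
  assumes g: "g \<in> carrier G"
  shows "cdifferentiable_at (conj_map g) p"
proof -
  obtain V \<theta> where V: "(V, \<theta>) \<in> A" "g \<in> V" using exists_chart[OF g] by blast
  have f1: "cdifferentiable_at (\<lambda>y. \<theta> (g \<otimes> \<psi> y)) p"
    using left_translation_holomorphic[OF U V(1) one_U g] V g by simp
  have f2: "cdifferentiable_at (\<lambda>y. \<phi> (inv_into V \<theta> y \<otimes> inv g)) (\<theta> g)"
    using right_translation_holomorphic[OF V(1) U V(2)] g one_U by simp
  have c: "cdifferentiable_at (\<lambda>y. \<phi> (inv_into V \<theta> (\<theta> (g \<otimes> \<psi> y)) \<otimes> inv g)) p"
    by (rule cdifferentiable_at_compose(1)[where f = "\<lambda>y. \<phi> (inv_into V \<theta> y \<otimes> inv g)", OF f1]) (use f2 g \<psi>_p in simp)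
  have "eventually (\<lambda>y. y \<in> P \<and> \<psi> y \<in> {x \<in> carrier G. g \<otimes> x \<in> V}) (nhds p)"
    by (rule eventually_\<psi>[OF p_P openin_left_translation[OF chart_facts(1)[OF V(1)] g]]) (use g V \<psi>_p in simp)
  then have "eventually (\<lambda>y. \<phi> (inv_into V \<theta> (\<theta> (g \<otimes> \<psi> y)) \<otimes> inv g) = conj_map g y) (nhds p)"
    by (rule eventually_mono) (simp add: conj_map_def inv_into_f_f[OF chart_facts(4)[OF V(1)]])
  then show ?thesis by (rule cdifferentiable_at_cong(1)[OF _ c])
qed

lemma clinear_Ad: "g \<in> carrier G \<Longrightarrow> clinear (ad_hom g)"
  unfolding Ad_eq by (rule cdifferentiable_atD(2)[OF conj_map_holomorphic])

lemma Ad_mult: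
  assumes g: "g \<in> carrier G" and h: "h \<in> carrier G"
  shows "ad_hom (g \<otimes> h) X = ad_hom g (ad_hom h X)"
proof -
  have ev: "eventually (\<lambda>y. conj_map g (conj_map h y) = conj_map (g \<otimes> h) y) (nhds p)"
    using eventually_conj[OF h]
  proof (rule eventually_mono)
    fix y assume y: "y \<in> P \<and> h \<otimes> \<psi> y \<otimes> inv h \<in> U"
    then have "\<psi> y \<in> carrier G" using \<psi>_carrier by blast
    then show "conj_map g (conj_map h y) = conj_map (g \<otimes> h) y"
      using g h y by (simp add: conj_map_def \<psi>_\<phi> inv_mult_group m_assoc)
  qed
  have c: "cdifferentiable_at (conj_map g) (conj_map h p)"
    using conj_map_holomorphic[OF g] by (simp add: conj_map_p[OF h])
  note comp = cdifferentiable_at_compose[OF conj_map_holomorphic[OF h] c]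
  show ?thesis
    unfolding Ad_eq cdifferentiable_at_cong(2)[OF ev comp(1)] comp(2) by (simp add: conj_map_p[OF h])
qed

lemma Ad_one: "ad_hom \<one> X = X"
proof -
  have "eventually (\<lambda>y. y = conj_map \<one> y) (nhds p)"
    using eventually_P[OF p_P] by (rule eventually_mono) (simp add: conj_map_def \<psi>_carrier \<phi>_\<psi>)
  from cdifferentiable_at_cong(2)[OF this cdifferentiable_at_id]
  have "ad_hom \<one> = FD (\<lambda>y. y) p" unfolding Ad_eq .
  also have "FD (\<lambda>y. y) p = (\<lambda>y. y)" using frechet_derivative_at[OF has_derivative_ident] by metis
  finally show ?thesis by simp
qed

lemma Ad_inv: "g \<in> carrier G \<Longrightarrow> ad_hom g (ad_hom (inv g) X) = X" "g \<in> carrier G \<Longrightarrow> ad_hom (inv g) (ad_hom g X) = X"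
  by (simp_all add: Ad_one flip: Ad_mult)

section \<open>Holomorphy of the adjoint action\<close>

definition conj2 :: "(complex^'n) \<times> (complex^'n) \<Rightarrow> complex^'n" where
  "conj2 q = \<phi> (\<psi> (fst q) \<otimes> \<psi> (snd q) \<otimes> inv (\<psi> (fst q)))"

text \<open>The intermediate product and the inverse are also kept in \<open>U\<close>, so that
  \<open>conj2\<close> is composed of multiplication and inversion expressed in this one
  chart.\<close>

definition conj2_domain :: "((complex^'n) \<times> (complex^'n)) set" where
  "conj2_domain = {q \<in> P \<times> P. \<psi> (fst q) \<otimes> \<psi> (snd q) \<in> U \<and> inv (\<psi> (fst q)) \<in> U \<and>
      \<psi> (fst q) \<otimes> \<psi> (snd q) \<otimes> inv (\<psi> (fst q)) \<in> U}"

lemma open_conj2_domain: "open conj2_domain"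
proof -
  let ?X = "top_of_set (P \<times> P)"
  have \<psi>: "continuous_map (top_of_set P) T \<psi>"
  proof -
    have "openin (top_of_set P) {y \<in> P. \<psi> y \<in> W}" if "openin T W" for W
    proof -
      have "{y \<in> P. \<psi> y \<in> W} = \<phi> ` (U \<inter> W)" by (auto simp: \<psi>_\<phi>)
      then show ?thesis using open_chart_image[OF U that] open_P by (auto simp: openin_open_eq)
    qed
    then show ?thesis by (auto simp: continuous_map_def topspace_eq \<psi>_carrier)
  qed
  have 1: "continuous_map ?X T (\<lambda>q. \<psi> (fst q))"
    using continuous_map_compose[OF _ \<psi>, of ?X fst] by (simp add: o_def continuous_on_fst Pi_def)
  have 2: "continuous_map ?X T (\<lambda>q. \<psi> (snd q))"
    using continuous_map_compose[OF _ \<psi>, of ?X snd] by (simp add: o_def continuous_on_snd Pi_def)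
  have mult: "continuous_map ?X T (\<lambda>q. f q \<otimes> h q)"
    if "continuous_map ?X T f" "continuous_map ?X T h" for f h
    using continuous_map_compose[OF continuous_map_pairedI[OF that] mult_continuous] by (simp add: o_def)
  have 3: "continuous_map ?X T (\<lambda>q. inv (\<psi> (fst q)))"
    using continuous_map_compose[OF 1 inv_continuous] by (simp add: o_def)
  have o: "open {q \<in> P \<times> P. f q \<in> U}" if "continuous_map ?X T f" for f
  proof -
    have "openin ?X {q \<in> topspace ?X. f q \<in> U}"
      by (rule openin_continuous_map_preimage[OF that chart_facts(1)[OF U]])
    moreover have "open (P \<times> P)" using open_P by (intro open_Times)
    ultimately show ?thesis by (simp add: openin_open_eq)
  qed
  have "conj2_domain = {q \<in> P \<times> P. \<psi> (fst q) \<otimes> \<psi> (snd q) \<in> U} \<inter> {q \<in> P \<times> P. inv (\<psi> (fst q)) \<in> U}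
     \<inter> {q \<in> P \<times> P. \<psi> (fst q) \<otimes> \<psi> (snd q) \<otimes> inv (\<psi> (fst q)) \<in> U}"
    by (auto simp: conj2_domain_def)
  also have "open \<dots>" by (intro open_Int o mult 1 2 3)
  finally show ?thesis .
qed

lemma conj2_holomorphic:
  assumes q: "q \<in> conj2_domain"
  shows "cdifferentiable2_at conj2 q"
proof -
  define m where "m q = \<phi> (\<psi> (fst q) \<otimes> \<psi> (snd q))" for q
  define i where "i x = \<phi> (inv (\<psi> x))" for x
  obtain x y where xy: "q = (x, y)" by (cases q)
  have *: "x \<in> P" "y \<in> P" "\<psi> x \<otimes> \<psi> y \<in> U" "inv (\<psi> x) \<in> U" "\<psi> x \<otimes> \<psi> y \<otimes> inv (\<psi> x) \<in> U"
    using q by (auto simp: conj2_domain_def xy)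
  have m: "cdifferentiable2_at m (\<phi> a, \<phi> b)" if "a \<in> U" "b \<in> U" "a \<otimes> b \<in> U" for a b
    using mult_holomorphic[OF U U U that] by (simp add: m_def[abs_def] case_prod_beta')
  have m1: "cdifferentiable2_at m (x, y)"
    using m[OF \<psi>_U[OF *(1)] \<psi>_U[OF *(2)] *(3)] * by (simp add: \<phi>_\<psi>)
  have i1: "cdifferentiable_at i x"
    using inv_holomorphic[OF U U \<psi>_U[OF *(1)] *(4)] * by (simp add: \<phi>_\<psi> i_def[abs_def])
  have m2: "cdifferentiable2_at m (m (x, y), i x)"
    using m[OF *(3,4,5)] by (simp add: m_def i_def)
  have D: "((\<lambda>q. m (m q, i (fst q))) has_derivative
      (\<lambda>v. FD m (m (x, y), i x) (FD m (x, y) v, FD i x (fst v)))) (at (x, y))"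
  proof (rule has_derivative_compose[where f = "\<lambda>q. (m q, i (fst q))" and f' = "\<lambda>v. (FD m (x, y) v, FD i x (fst v))"])
    have "((\<lambda>q. i (fst q)) has_derivative (\<lambda>v. FD i x (fst v))) (at (x, y))"
      by (rule has_derivative_compose[where f = fst and f' = fst])
        (use cdifferentiable_atD(1)[OF i1] in \<open>auto intro!: derivative_eq_intros\<close>)
    then show "((\<lambda>q. (m q, i (fst q))) has_derivative (\<lambda>v. (FD m (x, y) v, FD i x (fst v)))) (at (x, y))"
      by (intro has_derivative_Pair cdifferentiable2_atD(1)[OF m1])
    show "(m has_derivative FD m (m (x, y), i x)) (at (m (x, y), i (fst (x, y))))"
      using cdifferentiable2_atD(1)[OF m2] by simp
  qed
  have "(conj2 has_derivative (\<lambda>v. FD m (m (x, y), i x) (FD m (x, y) v, FD i x (fst v)))) (at q)"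
    unfolding xy
  proof (rule has_derivative_transform_within_open[OF D open_conj2_domain])
    show "(x, y) \<in> conj2_domain" using q xy by simp
    fix q assume "q \<in> conj2_domain"
    then show "m (m q, i (fst q)) = conj2 q"
      by (auto simp: conj2_domain_def m_def i_def conj2_def \<psi>_\<phi>)
  qed
  then show ?thesis
    unfolding cdifferentiable2_at_def
    by (intro exI conjI) (assumption, simp add: cdifferentiable2_atD(2)[OF m1] cdifferentiable2_atD(2)[OF m2]
        clinear_scale[OF cdifferentiable_atD(2)[OF i1]])
qed

lemma Ad_conj2:
  assumes "(x, p) \<in> conj2_domain"
  shows "ad_hom (\<psi> x) Y = FD conj2 (x, p) (0, Y)"
proof -
  have "conj_map (\<psi> x) = (\<lambda>y. conj2 (x, y))"
    by (simp add: conj_map_def conj2_def fun_eq_iff)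
  then have "ad_hom (\<psi> x) Y = FD (\<lambda>y. conj2 (x, y)) p Y" by (simp add: Ad_eq)
  also have "\<dots> = FD conj2 (x, p) (FD (\<lambda>y. x) p Y, FD (\<lambda>y. y) p Y)"
    by (rule cdifferentiable_at_Pair_compose(2)[OF cdifferentiable_at_const cdifferentiable_at_id conj2_holomorphic[OF assms]])
  also have "FD (\<lambda>y. x) p Y = 0" using fun_cong[OF frechet_derivative_at[OF has_derivative_const], of Y x p] by simp
  also have "FD (\<lambda>y. y) p Y = Y" using fun_cong[OF frechet_derivative_at[OF has_derivative_ident], of Y p] by simp
  finally show ?thesis .
qed

lemma p_conj2_domain: "(p, p) \<in> conj2_domain"
  using one_U by (simp add: conj2_domain_def \<psi>_p)

lemma Ad_holomorphic: "cdifferentiable_at (\<lambda>x. ad_hom (\<psi> x) Y) p"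
proof (rule cdifferentiable_at_cong)
  show "cdifferentiable_at (\<lambda>x. FD conj2 (x, p) (0, Y)) p"
    by (rule cdifferentiable_at_partial_FD[OF open_conj2_domain conj2_holomorphic p_conj2_domain])
  have "open ((\<lambda>x. (x, p)) -` conj2_domain)"
    by (intro open_vimage open_conj2_domain) (auto intro!: continuous_intros)
  then have "eventually (\<lambda>x. x \<in> (\<lambda>x. (x, p)) -` conj2_domain) (nhds p)"
    using p_conj2_domain by (intro eventually_nhds_in_open) auto
  then show "eventually (\<lambda>x. FD conj2 (x, p) (0, Y) = ad_hom (\<psi> x) Y) (nhds p)"
    by (rule eventually_mono) (simp add: Ad_conj2)
qed

section \<open>The bracket as the derivative of the adjoint action\<close>

lemma bracket_eq: "br X Y = FD (\<lambda>y. ad_hom (\<psi> y) Y) p X"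
  by (simp add: bracket_def)

lemma clinear_bracket_left: "clinear (\<lambda>X. br X Y)"
  unfolding bracket_eq using cdifferentiable_atD(2)[OF Ad_holomorphic] by simp

lemma Ad_has_derivative: "((\<lambda>y. ad_hom (\<psi> y) Y) has_derivative (\<lambda>X. br X Y)) (at p)"
  using cdifferentiable_atD(1)[OF Ad_holomorphic, of Y] by (simp add: bracket_eq[abs_def])

lemma bracket_unique:
  assumes "(f has_derivative D) (at p)" "eventually (\<lambda>y. f y = ad_hom (\<psi> y) Y) (nhds p)"
  shows "D X = br X Y"
proof -
  have "eventually (\<lambda>y. f y = ad_hom (\<psi> y) Y) (at p)" "f p = ad_hom (\<psi> p) Y"
    using assms(2) by (auto simp: eventually_nhds_conv_at)
  then have "((\<lambda>y. ad_hom (\<psi> y) Y) has_derivative D) (at p)"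
    using has_derivative_transform_eventually[OF assms(1), of "\<lambda>y. ad_hom (\<psi> y) Y"] by simp
  from has_derivative_unique[OF this Ad_has_derivative] show ?thesis by simp
qed

lemma clinear_bracket_right: "clinear (br X)"
proof (rule clinearI)
  fix Y Z c
  have "eventually (\<lambda>y. ad_hom (\<psi> y) Y + ad_hom (\<psi> y) Z = ad_hom (\<psi> y) (Y + Z)) (nhds p)"
    using eventually_P[OF p_P] by (rule eventually_mono) (simp add: clinear_add[OF clinear_Ad[OF \<psi>_carrier]])
  from bracket_unique[OF has_derivative_add[OF Ad_has_derivative Ad_has_derivative] this]
  show "br X (Y + Z) = br X Y + br X Z" by simp
  have "eventually (\<lambda>y. c *s ad_hom (\<psi> y) Y = ad_hom (\<psi> y) (c *s Y)) (nhds p)"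
    using eventually_P[OF p_P] by (rule eventually_mono) (simp add: clinear_scale[OF clinear_Ad[OF \<psi>_carrier]])
  from bracket_unique[OF bounded_linear.has_derivative[OF
      bounded_bilinear.bounded_linear_right[OF bounded_bilinear_smult] Ad_has_derivative] this]
  show "br X (c *s Y) = c *s br X Y" by simp
qed

text \<open>Conjugating \<open>x\<close> by \<open>g\<close> and then multiplying by
  \<open>g\<close> gives the product of \<open>g\<close> and \<open>x\<close>. Apply
  \<open>Ad\<close> to this identity and differentiate in \<open>x\<close> at the unit.\<close>

lemma Ad_bracket:
  assumes g: "g \<in> carrier G"
  shows "ad_hom g (br X Y) = br (ad_hom g X) (ad_hom g Y)"
proof -
  let ?Y = "ad_hom g Y"
  have c: "cdifferentiable_at (\<lambda>x. ad_hom (\<psi> x) ?Y) (conj_map g p)"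
    using Ad_holomorphic by (simp add: conj_map_p[OF g])
  note comp = cdifferentiable_at_compose[OF conj_map_holomorphic[OF g] c]
  have "eventually (\<lambda>x. ad_hom (\<psi> (conj_map g x)) ?Y = ad_hom g (ad_hom (\<psi> x) Y)) (nhds p)"
    using eventually_conj[OF g]
  proof (rule eventually_mono)
    fix x assume x: "x \<in> P \<and> g \<otimes> \<psi> x \<otimes> inv g \<in> U"
    then have \<psi>x: "\<psi> x \<in> carrier G" using \<psi>_carrier by blast
    have "ad_hom (\<psi> (conj_map g x)) ?Y = ad_hom (g \<otimes> \<psi> x \<otimes> inv g \<otimes> g) Y"
      using x g \<psi>x by (simp add: conj_map_def \<psi>_\<phi> Ad_mult[of "g \<otimes> \<psi> x \<otimes> inv g" g])
    also have "g \<otimes> \<psi> x \<otimes> inv g \<otimes> g = g \<otimes> \<psi> x" using g \<psi>x by (simp add: m_assoc)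
    finally show "ad_hom (\<psi> (conj_map g x)) ?Y = ad_hom g (ad_hom (\<psi> x) Y)" using g \<psi>x by (simp add: Ad_mult)
  qed
  from cdifferentiable_at_cong(2)[OF this comp(1)] comp(2)[of X]
  have "FD (\<lambda>x. ad_hom g (ad_hom (\<psi> x) Y)) p X = br (ad_hom g X) ?Y"
    by (simp add: conj_map_p[OF g] bracket_eq Ad_eq[of g])
  moreover have "FD (\<lambda>x. ad_hom g (ad_hom (\<psi> x) Y)) p X = ad_hom g (br X Y)"
    using cdifferentiable_at_compose(2)[OF Ad_holomorphic clinear_cdifferentiable(1)[OF clinear_Ad[OF g]]]
    by (simp add: clinear_cdifferentiable(2)[OF clinear_Ad[OF g]] bracket_eq)
  ultimately show ?thesis by simp
qed

text \<open>Differentiate \<open>Ad_bracket\<close> in the group element at the unit; the product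
  rule gives the two terms on the right.\<close>

lemma bracket_leibniz: "br X (br Y Z) = br (br X Y) Z + br Y (br X Z)"
proof -
  have bil: "bounded_bilinear br"
  proof -
    have "bilinear br"
      unfolding bilinear_def using clinear_imp_linear[OF clinear_bracket_left] clinear_imp_linear[OF clinear_bracket_right] by blast
    then show ?thesis by (simp add: bilinear_conv_bounded_bilinear)
  qed
  have "eventually (\<lambda>y. br (ad_hom (\<psi> y) Y) (ad_hom (\<psi> y) Z) = ad_hom (\<psi> y) (br Y Z)) (nhds p)"
    using eventually_P[OF p_P] by (rule eventually_mono) (simp add: Ad_bracket[OF \<psi>_carrier])
  from bracket_unique[OF bounded_bilinear.FDERIV[OF bil Ad_has_derivative Ad_has_derivative] this, of X]
  show ?thesis by (simp add: \<psi>_p Ad_one add.commute)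
qed

sublocale leibniz_bracket br
  by (intro leibniz_bracket.intro bilinear_bracket.intro leibniz_bracket_axioms.intro
      clinear_bracket_left clinear_bracket_right bracket_leibniz)

subsection \<open>Stabilizers and their Lie algebras\<close>

lemma semisimple_lie_bracket:
  assumes "lie_semisimple br"
  shows "lie_bracket br"
  by (intro lie_bracket.intro leibniz_bracket_axioms lie_bracket_axioms.intro)
    (rule semisimple_imp_alternating[OF assms])

text \<open>Each \<open>ad_hom g\<close> is an automorphism of the bracket, so it preserves sandwich
  elements. Hence \<open>ad_hom (\<psi> y) Z\<close> stays in their span near the unit, and so does
  its derivative.\<close>

lemma sandwich_invariant:
  assumes "lie_semisimple br" and Z: "Z \<in> lie_bracket.sandwich br"
  shows "br X Z \<in> vec.span (lie_bracket.sandwich br)"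
proof -
  interpret L: lie_bracket br by (rule semisimple_lie_bracket[OF assms(1)])
  have Ad: "ad_hom g Z \<in> L.sandwich" if g: "g \<in> carrier G" for g
  proof -
    have "br (ad_hom g Z) (br (ad_hom g Z) Y) = 0" for Y
    proof -
      have "br (ad_hom g Z) (br (ad_hom g Z) (ad_hom g (ad_hom (inv g) Y))) = ad_hom g (br Z (br Z (ad_hom (inv g) Y)))"
        by (simp only: Ad_bracket[OF g])
      then show ?thesis by (simp add: Ad_inv[OF g] L.sandwichD[OF Z] clinear_zero[OF clinear_Ad[OF g]])
    qed
    then show ?thesis by (simp add: L.sandwich_def)
  qed
  have "eventually (\<lambda>y. ad_hom (\<psi> y) Z \<in> vec.span L.sandwich) (nhds p)"
    using eventually_P[OF p_P] by (rule eventually_mono) (intro vec.span_base Ad \<psi>_carrier)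
  then show ?thesis
    unfolding bracket_eq by (intro FD_in_subspace Ad_holomorphic) auto
qed

abbreviation stabilizer :: "complex^'n \<Rightarrow> 'g set" where
  "stabilizer \<equiv> coad_stabilizer G U \<phi>"

lemma pairing_coAd:
  assumes "g \<in> carrier G"
  shows "pairing (coAd G U \<phi> g \<xi>) Y = pairing \<xi> (ad_hom (inv g) Y)"
  unfolding coAd_def by (rule pairing_linear_expansion[OF clinear_Ad]) (use assms in simp)

lemma pairing_eqI: "(\<And>Y. pairing \<xi> Y = pairing \<eta> Y) \<Longrightarrow> \<xi> = \<eta>"
  by (metis pairing_axis vec_eq_iff)

lemma stabilizer_iff:
  assumes "g \<in> carrier G"
  shows "g \<in> stabilizer \<xi> \<longleftrightarrow> (\<forall>Y. pairing \<xi> (ad_hom g Y) = pairing \<xi> Y)"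
proof -
  have "g \<in> stabilizer \<xi> \<longleftrightarrow> (\<forall>Y. pairing \<xi> (ad_hom (inv g) Y) = pairing \<xi> Y)"
    using assms pairing_eqI[of "coAd G U \<phi> g \<xi>" \<xi>] by (auto simp: coad_stabilizer_def simp flip: pairing_coAd)
  also have "\<dots> \<longleftrightarrow> (\<forall>Y. pairing \<xi> (ad_hom g Y) = pairing \<xi> Y)"
    by (metis Ad_inv assms)
  finally show ?thesis .
qed

lemma stabilizer_carrier: "stabilizer \<xi> \<subseteq> carrier G"
  by (auto simp: coad_stabilizer_def)

lemma one_stabilizer: "\<one> \<in> stabilizer \<xi>"
  by (simp add: stabilizer_iff Ad_one)

lemma stabilizer_inv_mult:
  assumes "g \<in> stabilizer \<xi>" "h \<in> stabilizer \<xi>"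
  shows "inv g \<otimes> h \<in> stabilizer \<xi>"
proof -
  have c: "g \<in> carrier G" "h \<in> carrier G" using assms stabilizer_carrier by blast+
  have "pairing \<xi> (ad_hom (inv g) Y) = pairing \<xi> Y" for Y
    using assms(1) stabilizer_iff[OF c(1)] Ad_inv(1)[OF c(1)] by metis
  then show ?thesis using assms(2) c by (simp add: stabilizer_iff Ad_mult)
qed

text \<open>The coadjoint orbit map after inversion, in the chart. Inversion preserves the fibre
  over \<xi>, the stabilizer, and makes the derivative at the unit \<open>coad \<xi>\<close> without
  a sign.\<close>

definition orbit_map :: "complex^'n \<Rightarrow> complex^'n \<Rightarrow> complex^'n" where
  "orbit_map \<xi> y = (\<chi> i. pairing \<xi> (ad_hom (\<psi> y) (axis i 1)))"

lemma pairing_orbit_map: "y \<in> P \<Longrightarrow> pairing (orbit_map \<xi> y) Y = pairing \<xi> (ad_hom (\<psi> y) Y)"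
  unfolding orbit_map_def by (rule pairing_linear_expansion[OF clinear_Ad[OF \<psi>_carrier]])

lemma orbit_map_eq_iff: "y \<in> P \<Longrightarrow> orbit_map \<xi> y = \<xi> \<longleftrightarrow> \<psi> y \<in> stabilizer \<xi>"
  using pairing_eqI[of "orbit_map \<xi> y" \<xi>] by (auto simp: stabilizer_iff[OF \<psi>_carrier] simp flip: pairing_orbit_map)

lemma orbit_map_p: "orbit_map \<xi> p = \<xi>"
  by (simp add: orbit_map_eq_iff[OF p_P] \<psi>_p one_stabilizer)

definition rtrans :: "complex^'n \<Rightarrow> complex^'n \<Rightarrow> complex^'n" where
  "rtrans x0 x = \<phi> (\<psi> x \<otimes> inv (\<psi> x0))"

lemma rtrans_holomorphic: "x0 \<in> P \<Longrightarrow> cdifferentiable_at (rtrans x0) x0"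
  unfolding rtrans_def[abs_def]
  using right_translation_holomorphic[OF U U \<psi>_U, of x0 "inv (\<psi> x0)"] one_U \<psi>_carrier[of x0]
  by (simp add: \<phi>_\<psi>)

lemma rtrans_self: "x0 \<in> P \<Longrightarrow> rtrans x0 x0 = p"
  by (simp add: rtrans_def \<psi>_carrier)

lemma eventually_rtrans:
  assumes "x0 \<in> P"
  shows "eventually (\<lambda>x. x \<in> P \<and> \<psi> x \<otimes> inv (\<psi> x0) \<in> U) (nhds x0)"
proof -
  have "eventually (\<lambda>y. y \<in> P \<and> \<psi> y \<in> {x \<in> carrier G. x \<otimes> inv (\<psi> x0) \<in> U}) (nhds x0)"
    by (rule eventually_\<psi>[OF assms openin_right_translation[OF chart_facts(1)[OF U]]])
       (use assms one_U \<psi>_carrier in simp_all)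
  then show ?thesis by (rule eventually_mono) simp
qed

text \<open>Write \<open>\<psi> x\<close> as the product of
  \<open>\<psi> x \<otimes> inv (\<psi> x0)\<close> and \<open>\<psi> x0\<close>. The first factor
  is near the unit, where \<open>Ad\<close> is already known to be holomorphic.\<close>

lemma Ad_holomorphic_at:
  assumes x0: "x0 \<in> P"
  shows "cdifferentiable_at (\<lambda>x. ad_hom (\<psi> x) Y) x0"
    "FD (\<lambda>x. ad_hom (\<psi> x) Y) x0 v = br (FD (rtrans x0) x0 v) (ad_hom (\<psi> x0) Y)"
proof -
  let ?Y = "ad_hom (\<psi> x0) Y"
  have c: "cdifferentiable_at (\<lambda>x. ad_hom (\<psi> x) ?Y) (rtrans x0 x0)"
    using Ad_holomorphic by (simp add: rtrans_self[OF x0])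
  note comp = cdifferentiable_at_compose[OF rtrans_holomorphic[OF x0] c]
  have ev: "eventually (\<lambda>x. ad_hom (\<psi> (rtrans x0 x)) ?Y = ad_hom (\<psi> x) Y) (nhds x0)"
    using eventually_rtrans[OF x0]
  proof (rule eventually_mono)
    fix x assume x: "x \<in> P \<and> \<psi> x \<otimes> inv (\<psi> x0) \<in> U"
    then show "ad_hom (\<psi> (rtrans x0 x)) ?Y = ad_hom (\<psi> x) Y"
      using \<psi>_carrier[of x] \<psi>_carrier[OF x0]
      by (simp add: rtrans_def \<psi>_\<phi> m_assoc flip: Ad_mult)
  qed
  show "cdifferentiable_at (\<lambda>x. ad_hom (\<psi> x) Y) x0"
    by (rule cdifferentiable_at_cong(1)[OF ev comp(1)])
  show "FD (\<lambda>x. ad_hom (\<psi> x) Y) x0 v = br (FD (rtrans x0) x0 v) ?Y"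
    unfolding cdifferentiable_at_cong(2)[OF ev comp(1)] comp(2) by (simp add: rtrans_self[OF x0] bracket_eq)
qed

lemma orbit_map_holomorphic:
  assumes x0: "x0 \<in> P"
  shows "cdifferentiable_at (orbit_map \<xi>) x0"
    "FD (orbit_map \<xi>) x0 v = (\<chi> i. pairing \<xi> (br (FD (rtrans x0) x0 v) (ad_hom (\<psi> x0) (axis i 1))))"
proof -
  let ?D = "\<lambda>v. (\<chi> i. pairing \<xi> (br (FD (rtrans x0) x0 v) (ad_hom (\<psi> x0) (axis i 1))))"
  have bl: "bounded_linear (pairing \<xi>)"
    by (simp add: linear_conv_bounded_linear[symmetric] linear_iff pairing_add_right pairing_scale_right scaleR_eq_smult scaleR_conv_of_real[where 'a=complex])
  have *: "(orbit_map \<xi> has_derivative ?D) (at x0)"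
    unfolding has_derivative_vec_iff
  proof
    fix i
    have "((\<lambda>y. ad_hom (\<psi> y) (axis i 1)) has_derivative (\<lambda>v. br (FD (rtrans x0) x0 v) (ad_hom (\<psi> x0) (axis i 1)))) (at x0)"
      using cdifferentiable_atD(1)[OF Ad_holomorphic_at(1)[OF x0]] by (simp add: Ad_holomorphic_at(2)[OF x0, abs_def])
    from bounded_linear.has_derivative[OF bl this]
    show "((\<lambda>y. orbit_map \<xi> y $ i) has_derivative (\<lambda>v. ?D v $ i)) (at x0)"
      by (simp add: orbit_map_def)
  qed
  then show "cdifferentiable_at (orbit_map \<xi>) x0"
    by (rule cdifferentiable_atI)
      (simp add: vec_eq_iff clinear_scale[OF cdifferentiable_atD(2)[OF rtrans_holomorphic[OF x0]]] br_scale_left pairing_scale_right)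
  show "FD (orbit_map \<xi>) x0 v = ?D v"
    using fun_cong[OF frechet_derivative_at[OF *], of v] by simp
qed

lemma FD_orbit_map_p: "FD (orbit_map \<xi>) p = coad \<xi>"
proof -
  have "eventually (\<lambda>x. x = rtrans p x) (nhds p)"
    using eventually_P[OF p_P] by (rule eventually_mono) (simp add: rtrans_def \<psi>_p \<psi>_carrier \<phi>_\<psi>)
  from cdifferentiable_at_cong(2)[OF this cdifferentiable_at_id]
  have "FD (rtrans p) p v = v" for v
    by (simp add: FD_ident)
  then show ?thesis
    by (simp add: fun_eq_iff orbit_map_holomorphic(2)[OF p_P] coad_def \<psi>_p Ad_one)
qed

text \<open>The derivative of the orbit map at \<open>x0\<close> factors through that of
  \<open>rtrans x0\<close>. The derivative of the opposite translation \<open>s\<close> is a right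
  inverse of the latter, so it embeds \<open>stab \<xi>\<close> into the kernel.\<close>

lemma dim_ker_FD_orbit_map:
  assumes x0: "x0 \<in> P"
  shows "vec.dim (stab \<xi>) \<le> vec.dim {v. FD (orbit_map \<xi>) x0 v = 0}"
proof -
  define s where "s z = \<phi> (\<psi> z \<otimes> \<psi> x0)" for z
  have s_p: "s p = x0" using x0 by (simp add: s_def \<psi>_p \<psi>_carrier \<phi>_\<psi>)
  have s: "cdifferentiable_at s p"
    unfolding s_def[abs_def]
    using right_translation_holomorphic[OF U U one_U \<psi>_carrier[OF x0]] x0 \<psi>_U \<psi>_carrier by simp
  have r: "cdifferentiable_at (rtrans x0) (s p)" using rtrans_holomorphic[OF x0] by (simp add: s_p)
  note comp = cdifferentiable_at_compose[OF s r]
  have "eventually (\<lambda>y. y \<in> P \<and> \<psi> y \<in> {x \<in> carrier G. x \<otimes> \<psi> x0 \<in> U}) (nhds p)"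
    by (rule eventually_\<psi>[OF p_P openin_right_translation[OF chart_facts(1)[OF U]]])
       (use x0 \<psi>_U \<psi>_carrier \<psi>_p in simp_all)
  then have "eventually (\<lambda>y. rtrans x0 (s y) = y) (nhds p)"
    by (rule eventually_mono) (simp add: rtrans_def s_def \<psi>_\<phi> m_assoc \<psi>_carrier[OF x0] \<phi>_\<psi>)
  from cdifferentiable_at_cong(2)[OF this comp(1)] comp(2)
  have inv: "FD (rtrans x0) x0 (FD s p v) = v" for v
    by (metis FD_ident s_p)
  then have "inj_on (FD s p) (vec.span (stab \<xi>))" by (metis inj_onI)
  then have "vec.dim (FD s p ` stab \<xi>) = vec.dim (stab \<xi>)"
    by (rule vec.dim_image_eq[OF cdifferentiable_atD(2)[OF s]])
  moreover have "FD s p ` stab \<xi> \<subseteq> {v. FD (orbit_map \<xi>) x0 v = 0}"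
    by (auto simp: orbit_map_holomorphic(2)[OF x0] inv stab_iff vec_eq_iff)
  ultimately show ?thesis by (metis vec.dim_subset)
qed

section \<open>The Lie algebras of the group and of a stabilizer\<close>

lemma lie_algebra_of_carrier: "lie_algebra_of G U \<phi> (carrier G) = UNIV"
proof -
  have "X \<in> lie_algebra_of G U \<phi> (carrier G)" for X
  proof -
    have "eventually (\<lambda>t::real. p + t *\<^sub>R X \<in> P) (nhds 0)"
    proof -
      have "open ((\<lambda>t::real. p + t *\<^sub>R X) -` P)"
        by (intro open_vimage open_P continuous_intros)
      then have "eventually (\<lambda>t. t \<in> (\<lambda>t::real. p + t *\<^sub>R X) -` P) (nhds 0)"
        using one_U by (intro eventually_nhds_in_open) auto
      then show ?thesis by simp
    qed
    then obtain \<epsilon> where \<epsilon>: "\<epsilon> > 0" "\<And>t::real. \<bar>t\<bar> < \<epsilon> \<Longrightarrow> p + t *\<^sub>R X \<in> P"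
      unfolding eventually_nhds_metric by (auto simp: dist_real_def)
    define \<gamma> where "\<gamma> t = \<psi> (p + t *\<^sub>R X)" for t
    have eq: "(\<phi> \<circ> \<gamma>) t = p + t *\<^sub>R X" if "t \<in> {-\<epsilon><..<\<epsilon>}" for t
      using \<epsilon>(2)[of t] that by (auto simp: \<gamma>_def \<phi>_\<psi>)
    have D: "((\<phi> \<circ> \<gamma>) has_vector_derivative X) (at t)" if t: "t \<in> {-\<epsilon><..<\<epsilon>}" for t
    proof (rule has_vector_derivative_transform_within_open[where S = "{-\<epsilon><..<\<epsilon>}"])
      show "((\<lambda>t. p + t *\<^sub>R X) has_vector_derivative X) (at t)"
        by (auto intro!: derivative_eq_intros)
    qed (use t eq in auto)
    have "\<gamma> ` {-\<epsilon><..<\<epsilon>} \<subseteq> carrier G \<inter> U"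
      using \<epsilon>(2) \<psi>_U \<psi>_carrier by (auto simp: \<gamma>_def)
    moreover have "(\<phi> \<circ> \<gamma>) C1_differentiable_on {-\<epsilon><..<\<epsilon>}"
      unfolding C1_differentiable_on_def using D by (intro exI[of _ "\<lambda>_. X"]) auto
    moreover have "((\<phi> \<circ> \<gamma>) has_vector_derivative X) (at 0)" using D \<epsilon>(1) by simp
    moreover have "\<gamma> 0 = \<one>" by (simp add: \<gamma>_def \<psi>_p)
    ultimately show ?thesis using \<epsilon>(1) unfolding lie_algebra_of_def by blast
  qed
  then show ?thesis by blast
qed

text \<open>The orbit map is constant along a curve in the stabilizer, and its derivative at the
  unit is \<open>coad \<xi>\<close>.\<close>

lemma lie_algebra_of_stabilizer_subset: "lie_algebra_of G U \<phi> (stabilizer \<xi>) \<subseteq> stab \<xi>"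
proof
  fix X assume "X \<in> lie_algebra_of G U \<phi> (stabilizer \<xi>)"
  then obtain \<gamma> \<epsilon> where \<epsilon>: "\<epsilon> > 0" and \<gamma>0: "\<gamma> 0 = \<one>" and \<gamma>: "\<gamma> ` {-\<epsilon><..<\<epsilon>} \<subseteq> stabilizer \<xi> \<inter> U"
    and D: "((\<phi> \<circ> \<gamma>) has_vector_derivative X) (at (0::real))"
    unfolding lie_algebra_of_def by blast
  have "(orbit_map \<xi> has_derivative coad \<xi>) (at ((\<phi> \<circ> \<gamma>) 0))"
    using cdifferentiable_atD(1)[OF orbit_map_holomorphic(1)[OF p_P]] by (simp add: \<gamma>0 FD_orbit_map_p)
  from has_derivative_compose[OF D[unfolded has_vector_derivative_def] this]
  have "((\<lambda>t. orbit_map \<xi> ((\<phi> \<circ> \<gamma>) t)) has_derivative (\<lambda>t. coad \<xi> (t *\<^sub>R X))) (at 0)" .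
  then have "((\<lambda>t. orbit_map \<xi> ((\<phi> \<circ> \<gamma>) t)) has_vector_derivative coad \<xi> X) (at 0)"
    by (simp add: has_vector_derivative_def linear_scale[OF clinear_imp_linear[OF clinear_coad]])
  moreover have "((\<lambda>t. orbit_map \<xi> ((\<phi> \<circ> \<gamma>) t)) has_vector_derivative 0) (at 0)"
  proof (rule has_vector_derivative_transform_within_open[where S = "{-\<epsilon><..<\<epsilon>}"])
    show "((\<lambda>t. \<xi>) has_vector_derivative 0) (at 0)" by (rule has_vector_derivative_const)
    fix t assume "t \<in> {-\<epsilon><..<\<epsilon>}"
    then have "\<gamma> t \<in> stabilizer \<xi>" "\<gamma> t \<in> U" using \<gamma> by blast+
    then show "\<xi> = orbit_map \<xi> ((\<phi> \<circ> \<gamma>) t)"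
      using orbit_map_eq_iff[of "\<phi> (\<gamma> t)" \<xi>] by (simp add: \<psi>_\<phi>)
  qed (use \<epsilon> in auto)
  ultimately have "coad \<xi> X = 0" by (rule vector_derivative_unique_at)
  then show "X \<in> stab \<xi>" by (simp add: stab_def)
qed

text \<open>By equivariance the rank of the orbit map is constant.  A straightening \<open>\<Phi>\<close> of the orbit map,
  whose derivative at the unit is the identity, turns the line \<open>t X\<close> into a curve in the stabilizer.\<close>

lemma stab_subset_lie_algebra_of_stabilizer: "stab \<xi> \<subseteq> lie_algebra_of G U \<phi> (stabilizer \<xi>)"
proof
  fix X assume X: "X \<in> stab \<xi>"
  define K where "K = stab \<xi>"
  have K: "vec.subspace K" by (simp add: K_def subspace_stab)
  obtain \<pi> where \<pi>: "clinear \<pi>" "range \<pi> \<subseteq> K" "\<And>x. x \<in> K \<Longrightarrow> \<pi> x = x"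
    using exists_projection[OF K] by metis
  have \<pi>K: "\<pi> x \<in> K" for x using \<pi>(2) by auto
  have ker_\<pi>: "vec.subspace {X. \<pi> X = 0}" by (rule subspace_kernel[OF \<pi>(1)])
  have "inj_on (coad \<xi>) {X. \<pi> X = 0}"
  proof (rule inj_onI)
    fix X Y assume "X \<in> {X. \<pi> X = 0}" "Y \<in> {X. \<pi> X = 0}" "coad \<xi> X = coad \<xi> Y"
    then have "\<pi> (X - Y) = 0" "X - Y \<in> K"
      using clinear_diff[OF \<pi>(1)] clinear_diff[OF clinear_coad] by (auto simp: K_def stab_def)
    then show "X = Y" using \<pi>(3) by force
  qed
  \<comment> \<open>\<open>Q\<close> inverts \<open>coad \<xi>\<close> on the kernel of \<pi>, a
    complement of \<open>K\<close>, and takes values there. This keeps the two summands of \<Phi> in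
    complementary subspaces.\<close>
  from vec.linear_exists_left_inverse_on[OF clinear_coad ker_\<pi> this]
  obtain Q where Q: "range Q \<subseteq> {X. \<pi> X = 0}" "clinear Q" "\<And>X. \<pi> X = 0 \<Longrightarrow> Q (coad \<xi> X) = X" by auto
  have \<pi>Q: "\<pi> (Q x) = 0" for x using Q(1) by blast
  have Q_coad: "Q (coad \<xi> v) + \<pi> v = v" for v
  proof -
    have "\<pi> (v - \<pi> v) = 0" by (simp add: clinear_diff[OF \<pi>(1)] \<pi>(3)[OF \<pi>K])
    then have "Q (coad \<xi> (v - \<pi> v)) = v - \<pi> v" by (rule Q(3))
    moreover have "coad \<xi> (v - \<pi> v) = coad \<xi> v"
      using \<pi>K[of v] by (simp add: clinear_diff[OF clinear_coad] K_def stab_def)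
    ultimately show ?thesis by simp
  qed
  define \<Phi> where "\<Phi> y = Q (orbit_map \<xi> y - \<xi>) + \<pi> (y - p)" for y
  define L where "L y v = Q (FD (orbit_map \<xi>) y v) + \<pi> v" for y v
  have L: "clinear (L y)" if "y \<in> P" for y
    using cdifferentiable_atD(2)[OF orbit_map_holomorphic(1)[OF that], of \<xi>]
    by (intro clinearI) (simp_all add: L_def clinear_add clinear_scale Q(2) \<pi>(1) vec.scale_right_distrib)
  have D\<Phi>: "(\<Phi> has_derivative L y) (at y)" if "y \<in> P" for y
  proof -
    have "((\<lambda>y. orbit_map \<xi> y - \<xi>) has_derivative FD (orbit_map \<xi>) y) (at y)"
      using has_derivative_diff[OF cdifferentiable_atD(1)[OF orbit_map_holomorphic(1)[OF that]] has_derivative_const, of \<xi> \<xi>]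
      by simp
    moreover have "((\<lambda>y. y - p) has_derivative (\<lambda>v. v)) (at y)"
      by (auto intro!: derivative_eq_intros)
    ultimately show ?thesis
      unfolding \<Phi>_def[abs_def] L_def[abs_def]
      by (intro has_derivative_add bounded_linear.has_derivative[OF clinear_imp_bounded_linear[OF Q(2)]]
        bounded_linear.has_derivative[OF clinear_imp_bounded_linear[OF \<pi>(1)]])
  qed
  define f' where "f' y = Blinfun (L y)" for y
  have f': "blinfun_apply (f' y) = L y" if "y \<in> P" for y
    unfolding f'_def using has_derivative_bounded_linear[OF D\<Phi>[OF that]] by (simp add: bounded_linear_Blinfun_apply)
  have cont: "continuous_on P f'"
  proof (rule continuous_on_blinfun_componentwise)
    fix i :: "complex^'n"
    have "continuous_on P (\<lambda>y. L y i)"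
      unfolding L_def
      by (intro continuous_intros bounded_linear.continuous_on[OF clinear_imp_bounded_linear[OF Q(2)]]
          continuous_on_FD open_P orbit_map_holomorphic)
    then show "continuous_on P (\<lambda>y. blinfun_apply (f' y) i)"
      by (rule continuous_on_eq) (simp add: f')
  qed
  have "blinfun_apply (f' p) v = v" for v
    by (simp add: f'[OF p_P] L_def FD_orbit_map_p Q_coad)
  then have f'p: "id_blinfun o\<^sub>L f' p = id_blinfun" by (intro blinfun_eqI) simp
  have Df': "(\<Phi> has_derivative blinfun_apply (f' y)) (at y)" if "y \<in> P" for y
    using D\<Phi>[OF that] by (simp add: f'[OF that])
  obtain U' V g g' where U': "U' \<subseteq> P" "p \<in> U'" and V: "open V" "\<Phi> p \<in> V"
    and hom: "homeomorphism U' V \<Phi> g"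
    and Dg: "\<And>y. y \<in> V \<Longrightarrow> (g has_derivative g' y) (at y)"
    and g': "\<And>y. y \<in> V \<Longrightarrow> g' y = inv_into UNIV (blinfun_apply (f' (g y)))"
    and bij: "\<And>y. y \<in> V \<Longrightarrow> bij (blinfun_apply (f' (g y)))"
    by (rule inverse_function_theorem[OF open_P Df' cont p_P f'p], assumption) (rule that)
  have \<Phi>p: "\<Phi> p = 0"
    by (simp add: \<Phi>_def orbit_map_p clinear_zero[OF Q(2)] clinear_zero[OF \<pi>(1)])
  have gp: "g 0 = p" using homeomorphism_apply1[OF hom U'(2)] by (simp add: \<Phi>p)
  have gP: "g y \<in> P" if "y \<in> V" for y
    using homeomorphism_image2[OF hom] that U'(1) by blast
  have L_bij: "bij (L (g y))" if "y \<in> V" for y using bij[OF that] f'[OF gP[OF that]] by simp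
  have L_g': "L (g y) (g' y v) = v" if "y \<in> V" for y v
    using bij_is_surj[OF L_bij[OF that]] g'[OF that] f'[OF gP[OF that]] by (simp add: surj_f_inv_f)
  \<comment> \<open>Complex linearity of the derivative of \<open>g\<close> is inherited from its
    inverse \<open>L\<close>. Holomorphy then provides the continuous derivative that a curve in the
    stabilizer must have.\<close>
  have g_hol: "cdifferentiable_at g y" if y: "y \<in> V" for y
  proof (rule cdifferentiable_atI[OF Dg[OF y]])
    fix c v
    have "L (g y) (g' y (c *s v)) = L (g y) (c *s g' y v)"
      by (simp add: L_g'[OF y] clinear_scale[OF L[OF gP[OF y]]])
    then show "g' y (c *s v) = c *s g' y v" using bij_is_inj[OF L_bij[OF y]] by (simp add: inj_eq)
  qed
  have FD_g: "FD g y = g' y" if "y \<in> V" for y using frechet_derivative_at[OF Dg[OF that]] by simp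
  \<comment> \<open>Constant rank: after composing the derivative of the orbit map with
    \<open>Q\<close>, the kernel is embedded into \<open>K\<close> by \<pi>, whereas the kernel
    before composing has at least the dimension of \<open>K\<close>. So composing with
    \<open>Q\<close> does not enlarge it.\<close>
  have kernel: "FD (orbit_map \<xi>) (g y) w = 0" if y: "y \<in> V" and w: "Q (FD (orbit_map \<xi>) (g y) w) = 0" for y w
  proof -
    let ?D = "FD (orbit_map \<xi>) (g y)"
    have D: "clinear ?D" by (rule cdifferentiable_atD(2)[OF orbit_map_holomorphic(1)[OF gP[OF y]]])
    have QD: "clinear (\<lambda>w. Q (?D w))"
      by (intro clinearI) (simp_all add: clinear_add clinear_scale D Q(2))
    have sub: "vec.subspace {w. Q (?D w) = 0}" "vec.subspace {w. ?D w = 0}"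
      by (rule subspace_kernel[OF QD] subspace_kernel[OF D])+
    have "inj_on \<pi> {w. Q (?D w) = 0}"
    proof (rule inj_onI)
      fix v w assume "v \<in> {w. Q (?D w) = 0}" "w \<in> {w. Q (?D w) = 0}" "\<pi> v = \<pi> w"
      then have "L (g y) v = L (g y) w" by (simp add: L_def)
      then show "v = w" using bij_is_inj[OF L_bij[OF y]] by (simp add: inj_eq)
    qed
    then have "vec.dim (\<pi> ` {w. Q (?D w) = 0}) = vec.dim {w. Q (?D w) = 0}"
      using vec.dim_image_eq[OF \<pi>(1), of "{w. Q (?D w) = 0}"] vec.span_eq_iff[THEN iffD2, OF sub(1)] by simp
    moreover have "\<pi> ` {w. Q (?D w) = 0} \<subseteq> K" using \<pi>K by blast
    ultimately have "vec.dim {w. Q (?D w) = 0} \<le> vec.dim K" by (metis vec.dim_subset)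
    also have "\<dots> \<le> vec.dim {w. ?D w = 0}"
      unfolding K_def by (rule dim_ker_FD_orbit_map[OF gP[OF y]])
    finally have "vec.dim {w. Q (?D w) = 0} \<le> vec.dim {w. ?D w = 0}" .
    moreover have "{w. ?D w = 0} \<subseteq> {w. Q (?D w) = 0}" by (auto simp: clinear_zero[OF Q(2)])
    ultimately have "{w. ?D w = 0} = {w. Q (?D w) = 0}"
      by (intro vec.subspace_dim_equal sub)
    then show ?thesis using w by blast
  qed
  have "eventually (\<lambda>t::real. t *\<^sub>R X \<in> V) (nhds 0)"
  proof -
    have "open ((\<lambda>t::real. t *\<^sub>R X) -` V)"
      by (intro open_vimage V continuous_intros)
    then have "eventually (\<lambda>t. t \<in> (\<lambda>t::real. t *\<^sub>R X) -` V) (nhds 0)"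
      using V(2) by (intro eventually_nhds_in_open) (auto simp: \<Phi>p)
    then show ?thesis by simp
  qed
  then obtain \<epsilon> where \<epsilon>: "\<epsilon> > 0" "\<And>t::real. \<bar>t\<bar> < \<epsilon> \<Longrightarrow> t *\<^sub>R X \<in> V"
    unfolding eventually_nhds_metric by (auto simp: dist_real_def)
  define I where "I = {-\<epsilon><..<\<epsilon>}"
  have I: "t *\<^sub>R X \<in> V" if "t \<in> I" for t using \<epsilon>(2)[of t] that by (auto simp: I_def)
  have D\<gamma>: "((\<lambda>t. g (t *\<^sub>R X)) has_vector_derivative FD g (t *\<^sub>R X) X) (at t)" if t: "t \<in> I" for t
  proof -
    have "((\<lambda>t. t *\<^sub>R X) has_derivative (\<lambda>s. s *\<^sub>R X)) (at t)"
      by (auto intro!: derivative_eq_intros)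
    from has_derivative_compose[OF this cdifferentiable_atD(1)[OF g_hol[OF I[OF t]]]]
    show ?thesis
      by (simp add: has_vector_derivative_def linear_scale[OF clinear_imp_linear[OF cdifferentiable_atD(2)[OF g_hol[OF I[OF t]]]]])
  qed
  have "((\<lambda>t. orbit_map \<xi> (g (t *\<^sub>R X))) has_vector_derivative 0) (at t within I)" if t: "t \<in> I" for t
  proof -
    let ?y = "t *\<^sub>R X" and ?w = "FD g (t *\<^sub>R X) X"
    have eq: "Q (FD (orbit_map \<xi>) (g ?y) ?w) + \<pi> ?w = X"
      using L_g'[OF I[OF t], of X] by (simp add: L_def FD_g[OF I[OF t]])
    \<comment> \<open>Compare components along \<open>K\<close>: \<open>X\<close> lies in
      \<open>K\<close> and the range of \<open>Q\<close> in the kernel of \<pi>, so the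
      \<open>Q\<close> part of \<open>eq\<close> is zero.\<close>
    have "\<pi> (Q (FD (orbit_map \<xi>) (g ?y) ?w) + \<pi> ?w) = \<pi> ?w"
      by (simp add: clinear_add[OF \<pi>(1)] \<pi>Q \<pi>(3)[OF \<pi>K])
    then have "\<pi> ?w = X" using eq \<pi>(3)[of X] X by (simp add: K_def)
    then have "Q (FD (orbit_map \<xi>) (g ?y) ?w) = 0" using eq by simp
    then have 0: "FD (orbit_map \<xi>) (g ?y) ?w = 0" by (rule kernel[OF I[OF t]])
    have F: "cdifferentiable_at (orbit_map \<xi>) (g ?y)" by (rule orbit_map_holomorphic(1)[OF gP[OF I[OF t]]])
    from has_derivative_compose[OF D\<gamma>[OF t, unfolded has_vector_derivative_def] cdifferentiable_atD(1)[OF F]]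
    have "((\<lambda>t. orbit_map \<xi> (g (t *\<^sub>R X))) has_vector_derivative 0) (at t)"
      by (simp add: has_vector_derivative_def linear_scale[OF clinear_imp_linear[OF cdifferentiable_atD(2)[OF F]]] 0)
    then show ?thesis by (rule has_vector_derivative_at_within)
  qed
  then obtain c where c: "\<And>t. t \<in> I \<Longrightarrow> orbit_map \<xi> (g (t *\<^sub>R X)) = c"
    using has_vector_derivative_zero_constant[of I "\<lambda>t. orbit_map \<xi> (g (t *\<^sub>R X))"] by (auto simp: I_def)
  have "c = \<xi>" using c[of 0] \<epsilon>(1) by (simp add: I_def gp orbit_map_p)
  define \<gamma> where "\<gamma> t = \<psi> (g (t *\<^sub>R X))" for t
  have eq: "(\<phi> \<circ> \<gamma>) t = g (t *\<^sub>R X)" if "t \<in> I" for t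
    using gP[OF I[OF that]] by (simp add: \<gamma>_def \<phi>_\<psi>)
  have D: "((\<phi> \<circ> \<gamma>) has_vector_derivative FD g (t *\<^sub>R X) X) (at t)" if t: "t \<in> I" for t
    by (rule has_vector_derivative_transform_within_open[OF D\<gamma>[OF t], where S = I])
      (use t eq in \<open>auto simp: I_def\<close>)
  have FD_g0: "FD g 0 X = X"
  proof -
    have "0 \<in> V" using V(2) \<Phi>p by simp
    then have "L p (FD g 0 X) = X" using L_g'[of 0 X] FD_g[of 0] gp by simp
    then show ?thesis by (simp add: L_def FD_orbit_map_p Q_coad)
  qed
  have cont_\<gamma>: "continuous_on I (\<lambda>t. FD g (t *\<^sub>R X) X)"
    by (rule continuous_on_compose2[OF continuous_on_FD[OF V(1) g_hol]]) (auto intro!: continuous_intros I)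
  have "(\<phi> \<circ> \<gamma>) C1_differentiable_on I"
    unfolding C1_differentiable_on_def
    by (intro exI[of _ "\<lambda>t. FD g (t *\<^sub>R X) X"] conjI ballI D cont_\<gamma>)
  moreover have "((\<phi> \<circ> \<gamma>) has_vector_derivative X) (at 0)"
    using D[of 0] \<epsilon>(1) by (simp add: I_def FD_g0)
  moreover have "\<gamma> ` I \<subseteq> stabilizer \<xi> \<inter> U"
  proof (rule image_subsetI)
    fix t assume t: "t \<in> I"
    show "\<gamma> t \<in> stabilizer \<xi> \<inter> U"
      using orbit_map_eq_iff[OF gP[OF I[OF t]], of \<xi>] c[OF t] \<open>c = \<xi>\<close> \<psi>_U[OF gP[OF I[OF t]]] by (simp add: \<gamma>_def)
  qed
  moreover have "\<gamma> 0 = \<one>" by (simp add: \<gamma>_def gp \<psi>_p)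
  ultimately show "X \<in> lie_algebra_of G U \<phi> (stabilizer \<xi>)"
    using \<epsilon>(1) unfolding lie_algebra_of_def I_def mem_Collect_eq by (intro exI conjI)
qed

lemma lie_algebra_of_stabilizer: "lie_algebra_of G U \<phi> (stabilizer \<xi>) = stab \<xi>"
  using lie_algebra_of_stabilizer_subset stab_subset_lie_algebra_of_stabilizer by blast

text \<open>The joint map \<open>F\<close> of all orbit maps has an injective derivative at
  \<open>p\<close>, bounded below by \<open>B\<close>. Once the linearization error is at most
  \<open>B / 2\<close> times the distance, no other nearby point has the same image as
  \<open>p\<close>.\<close>

lemma orbit_maps_isolated:
  fixes x :: "(complex^'n)^'N"
  assumes "(\<Inter>j. stab (x $ j)) = {0}"
  shows "\<exists>\<delta>>0. \<forall>y\<in>ball p \<delta>. (\<forall>j. orbit_map (x $ j) y = x $ j) \<longrightarrow> y = p"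
proof -
  define F where "F y = (\<chi> j. orbit_map (x $ j) y)" for y
  define D where "D v = (\<chi> j. coad (x $ j) v)" for v
  have F: "(F has_derivative D) (at p)"
    by (subst has_derivative_vec_iff)
      (use cdifferentiable_atD(1)[OF orbit_map_holomorphic(1)[OF p_P]] in \<open>simp add: F_def D_def FD_orbit_map_p\<close>)
  have "v = 0" if "D v = 0" for v
  proof -
    have "v \<in> (\<Inter>j. stab (x $ j))" using that by (simp add: D_def stab_def vec_eq_iff)
    then show ?thesis using assms by blast
  qed
  then have "inj D" using has_derivative_linear[OF F] linear_injective_0 by blast
  then obtain B where B: "B > 0" "\<And>v. B * norm v \<le> norm (D v)"
    using linear_inj_bounded_below_pos[OF has_derivative_linear[OF F]] by blast
  have "B / 2 > 0" using B(1) by simp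
  then obtain \<delta> where \<delta>: "\<delta> > 0" "\<And>y. norm (y - p) < \<delta> \<Longrightarrow> norm (F y - F p - D (y - p)) \<le> B / 2 * norm (y - p)"
    using F unfolding has_derivative_at_alt by blast
  have "y = p" if y: "y \<in> ball p \<delta>" "\<forall>j. orbit_map (x $ j) y = x $ j" for y
  proof -
    have "F y = F p" using y(2) by (simp add: F_def orbit_map_p)
    then have "norm (D (y - p)) \<le> B / 2 * norm (y - p)"
      using \<delta>(2)[of y] y(1) by (simp add: dist_norm norm_minus_commute)
    then have "B * norm (y - p) \<le> B / 2 * norm (y - p)" using B(2)[of "y - p"] by linarith
    then show ?thesis using B(1) by simp
  qed
  then show ?thesis using \<delta>(1) by blast
qed

text \<open>The common stabilizer is a group, so a neighbourhood \<open>W\<close> of the unit that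
  meets it only in the unit can be translated to isolate any other element \<open>h\<close>.\<close>

lemma discrete_stabilizer_Int:
  fixes x :: "(complex^'n)^'N"
  assumes "(\<Inter>j. stab (x $ j)) = {0}"
  shows "subtopology T (\<Inter>j. stabilizer (x $ j)) = discrete_topology (\<Inter>j. stabilizer (x $ j))"
  unfolding subtopology_eq_discrete_topology_eq
proof
  let ?H = "\<Inter>j. stabilizer (x $ j)"
  show "?H \<subseteq> topspace T" using stabilizer_carrier by (auto simp: topspace_eq)
  obtain \<delta> where \<delta>: "\<delta> > 0" "\<And>y. y \<in> ball p \<delta> \<Longrightarrow> \<forall>j. orbit_map (x $ j) y = x $ j \<Longrightarrow> y = p"
    using orbit_maps_isolated[OF assms] by blast
  define W where "W = {g \<in> U. \<phi> g \<in> ball p \<delta>}"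
  have W: "openin T W" unfolding W_def by (rule openin_chart_preimage[OF U open_ball])
  have W_H: "g = \<one>" if "g \<in> W" "g \<in> ?H" for g
  proof -
    have g: "g \<in> U" "\<phi> g \<in> ball p \<delta>" using that by (auto simp: W_def)
    have "\<forall>j. orbit_map (x $ j) (\<phi> g) = x $ j"
      using that(2) g(1) orbit_map_eq_iff[of "\<phi> g"] by (simp add: \<psi>_\<phi>)
    then have "\<phi> g = p" using \<delta>(2)[OF g(2)] by blast
    then show ?thesis using \<psi>_\<phi>[OF g(1)] \<psi>_p by metis
  qed
  have disjoint: "h \<notin> T derived_set_of ?H" if h: "h \<in> ?H" for h
  proof
    assume "h \<in> T derived_set_of ?H"
    have hc: "h \<in> carrier G" using h stabilizer_carrier[of "x $ undefined"] by auto
    define S where "S = {z \<in> carrier G. inv h \<otimes> z \<in> W}"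
    have "openin T S"
      unfolding S_def using hc by (intro openin_left_translation W) simp
    moreover have "h \<in> S"
      using hc one_U \<delta>(1) by (simp add: S_def W_def)
    ultimately have "\<exists>z. z \<noteq> h \<and> z \<in> ?H \<and> z \<in> S"
      using \<open>h \<in> T derived_set_of ?H\<close> unfolding in_derived_set_of by simp
    then obtain z where z: "z \<noteq> h" "z \<in> ?H" "z \<in> carrier G" "inv h \<otimes> z \<in> W"
      unfolding S_def by auto
    have "inv h \<otimes> z \<in> stabilizer (x $ j)" for j
      using h z(2) by (intro stabilizer_inv_mult) auto
    then have "inv h \<otimes> z \<in> ?H" by simp
    then have "inv h \<otimes> z = \<one>" by (rule W_H[OF z(4)])
    moreover have "z = h \<otimes> (inv h \<otimes> z)" using hc z(3) by (simp add: m_assoc[symmetric])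
    ultimately have "z = h" using hc by simp
    then show False using z(1) by simp
  qed
  show "?H \<inter> T derived_set_of ?H = {}" unfolding disjoint_iff by (intro allI impI disjoint)
qed

subsection \<open>Ranks\<close>

lemma poisson_rank_UNIV: "poisson_rank br UNIV \<xi> = vec.dim (UNIV :: (complex^'n) set) - vec.dim (stab \<xi>)"
proof -
  have "{X \<in> UNIV. \<forall>Y\<in>UNIV. pairing \<xi> (br X Y) = 0} = stab \<xi>" by (auto simp: stab_iff)
  then show ?thesis by (simp add: poisson_rank_def)
qed

text \<open>The Poisson bivector has maximal rank where the stabilizer is smallest. The assumption
  is \<open>regular\<close> written out, as that notion belongs to alternating brackets and this
  context has a Leibniz bracket.\<close>

lemma lie_rank_UNIV:
  assumes "\<And>\<eta>. vec.dim (stab \<xi>) \<le> vec.dim (stab \<eta>)"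
  shows "lie_rank br UNIV = vec.dim (stab \<xi>)"
proof -
  let ?n = "vec.dim (UNIV :: (complex^'n) set)"
  have "Max (range (poisson_rank br UNIV)) = ?n - vec.dim (stab \<xi>)"
  proof (rule Max_eqI)
    show "finite (range (poisson_rank br UNIV))"
      by (rule finite_subset[of _ "{..?n}"]) (auto simp: poisson_rank_UNIV)
    show "k \<le> ?n - vec.dim (stab \<xi>)" if "k \<in> range (poisson_rank br UNIV)" for k
      using that assms by (auto simp: poisson_rank_UNIV intro!: diff_le_mono2)
    show "?n - vec.dim (stab \<xi>) \<in> range (poisson_rank br UNIV)"
      by (metis poisson_rank_UNIV rangeI)
  qed
  moreover have "vec.dim (stab \<xi>) \<le> ?n" by (rule vec.dim_subset) simp
  ultimately show ?thesis by (simp add: lie_rank_def)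
qed

lemma lie_rank_abelian:
  assumes "\<And>X Y. X \<in> \<hh> \<Longrightarrow> Y \<in> \<hh> \<Longrightarrow> br X Y = 0"
  shows "lie_rank br \<hh> = vec.dim \<hh>"
proof -
  have "{X \<in> \<hh>. \<forall>Y\<in>\<hh>. pairing \<xi> (br X Y) = 0} = \<hh>" for \<xi>
    using assms by auto
  then have "poisson_rank br \<hh> \<xi> = 0" for \<xi> by (simp add: poisson_rank_def)
  then have "range (poisson_rank br \<hh>) = {0}" by auto
  then show ?thesis by (simp add: lie_rank_def)
qed

lemma product_orbit_refl:
  fixes x :: "(complex^'n)^'N"
  shows "x \<in> product_orbit G U \<phi> x"
proof -
  have "coAd G U \<phi> \<one> \<xi> = \<xi>" for \<xi>
    using one_stabilizer by (simp add: coad_stabilizer_def)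
  then have "x = (\<chi> j. coAd G U \<phi> ((\<lambda>_. \<one>) j) (x $ j))" by (simp add: vec_eq_iff)
  moreover have "\<forall>j :: 'N. (\<lambda>_. \<one>) j \<in> carrier G" by simp
  ultimately show ?thesis unfolding product_orbit_def mem_Collect_eq by (intro exI conjI)
qed

lemma generic_orbit_admissible:
  assumes ss: "lie_semisimple br" and N: "CARD('N::finite) \<ge> 2"
  shows "\<exists>\<Omega> :: ((complex^'n)^'N) set. open \<Omega> \<and> closure \<Omega> = UNIV \<and>
           (\<forall>x\<in>\<Omega>. admissible_orbit_of G T U \<phi> x)"
proof -
  interpret L: lie_bracket br by (rule semisimple_lie_bracket[OF ss])
  obtain j1 j2 :: 'N where j: "j1 \<noteq> j2"
  proof -
    have "\<not> (\<forall>a b :: 'N. a = b)"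
    proof
      assume "\<forall>a b :: 'N. a = b"
      then have "CARD('N) \<le> Suc 0" by (simp add: card_le_Suc0_iff_eq)
      then show False using N by simp
    qed
    then show ?thesis using that by blast
  qed
  have "\<exists>D :: ((complex^'n)^'N) set. open D \<and> closure D = UNIV \<and>
          (\<forall>x\<in>D. (\<forall>j. L.regular (x $ j)) \<and> (\<Inter>j. stab (x $ j)) = {0})"
    by (rule L.generic_stab[OF ss _ j]) (rule sandwich_invariant[OF ss])
  then obtain D :: "((complex^'n)^'N) set" where D: "open D" "closure D = UNIV"
    and D': "\<forall>x\<in>D. (\<forall>j. L.regular (x $ j)) \<and> (\<Inter>j. stab (x $ j)) = {0}"
    by (elim exE conjE)
  have D_reg: "L.regular (x $ j)" and D_Int: "(\<Inter>j. stab (x $ j)) = {0}" if "x \<in> D" for x j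
    using bspec[OF D' that] by simp_all
  have "admissible_orbit_of G T U \<phi> x" if x: "x \<in> D" for x
    unfolding admissible_orbit_of_def
  proof (intro conjI allI)
    show "\<exists>x'\<in>product_orbit G U \<phi> x.
       subtopology T (\<Inter>j. stabilizer (x' $ j)) = discrete_topology (\<Inter>j. stabilizer (x' $ j))"
      using product_orbit_refl discrete_stabilizer_Int[OF D_Int[OF x]] by blast
    fix j
    have "lie_rank br (stab (x $ j)) = vec.dim (stab (x $ j))"
      by (rule lie_rank_abelian) (rule L.stab_regular_abelian[OF D_reg[OF x]])
    moreover have "lie_rank br UNIV = vec.dim (stab (x $ j))"
      using D_reg[OF x] by (intro lie_rank_UNIV) (simp add: L.regular_def)
    ultimately show "group_rank G U \<phi> (stabilizer (x $ j)) = group_rank G U \<phi> (carrier G)"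
      by (simp add: group_rank_def lie_algebra_of_stabilizer lie_algebra_of_carrier)
  qed
  then show ?thesis using D by blast
qed

end

theorem mainTheorem5:
  fixes G :: "('g, 'b) monoid_scheme"
    and T :: "'g topology"
    and A :: "('g set \<times> ('g \<Rightarrow> complex^'n)) set"
    and U :: "'g set" and \<phi> :: "'g \<Rightarrow> complex^'n"
  assumes "complex_lie_group G T A"
    and "(U, \<phi>) \<in> A" and "\<one>\<^bsub>G\<^esub> \<in> U"
    and "lie_semisimple (bracket G U \<phi>)"
    and "CARD('N::finite) \<ge> 2"
  shows "\<exists>\<Omega> :: ((complex^'n)^'N) set. open \<Omega> \<and> closure \<Omega> = UNIV \<and>
           (\<forall>x\<in>\<Omega>. admissible_orbit_of G T U \<phi> x)"
proof -
  interpret lie_group_chart G T A U \<phi>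
    using assms(1-3) by (intro lie_group_chart.intro lie_group_chart_axioms.intro)
  show ?thesis by (rule generic_orbit_admissible[OF assms(4,5)])
qed

end
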